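(* For every $N\geq 2$, the following upper bound holds: $$\mathcal{E}_2(\mathbb{S}^2,N)\leq \frac14 N^2\log N+C_{\diamond,2}N^2+o(N^2),$$ where $o(N^2)$ is understood as $N\to\infty$ (over all integers $N$), $$C_{\diamond,2}=\frac12\Bigl(\gamma-\frac12-\frac{\log 2}{3}\Bigr),$$ and $\gamma$ is the Euler--Mascheroni constant.
   Context: $\mathbb{S}^2\subset\mathbb{R}^3$ is the unit sphere. For a set $\omega_N=\{x_1,\dots,x_N\}\subset\mathbb{S}^2$ of $N$ distinct points, $E_2(\omega_N)=\sum_{i\neq j}\|x_i-x_j\|^{-2}$ (sum over ordered pairs of distinct indices, Euclidean norm), and $\mathcal{E}_2(\mathbb{S}^2,N)=\min\{E_2(\omega_N):\omega_N\subset\mathbb{S}^2\}$ is the minimal Riesz $2$-energy of $N$ points. *)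

theory Defs
  imports "HOL-Analysis.Analysis" "HOL-Library.Landau_Symbols"
begin

definition S2 :: "(real^3) set" where
  "S2 = sphere 0 1"

text \<open>The sum ranges over ordered pairs of distinct points, so each unordered pair counts twice.\<close>

definition riesz2_energy :: "(real^3) set \<Rightarrow> real" where
  "riesz2_energy \<omega> = (\<Sum>(x, y)\<in>{(x, y). x \<in> \<omega> \<and> y \<in> \<omega> \<and> x \<noteq> y}. 1 / norm (x - y) ^ 2)"

definition configs :: "nat \<Rightarrow> (real^3) set set" where
  "configs N = {\<omega>. \<omega> \<subseteq> S2 \<and> finite \<omega> \<and> card \<omega> = N}"

text \<open>A genuine minimum: \<open>LEAST\<close> is unspecified if no least value exists; that one always
  exists is shown in \<open>min_riesz2_energy_attained\<close> below.\<close>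

definition min_riesz2_energy :: "nat \<Rightarrow> real" where
  "min_riesz2_energy N = (LEAST e. e \<in> riesz2_energy ` configs N)"

lemma infinite_S2: "infinite S2"
proof -
  have c: "connected S2" unfolding S2_def by (rule connected_sphere) simp
  let ?a = "axis 1 1 :: real^3"
  have "?a \<in> S2" "- ?a \<in> S2" by (auto simp: S2_def norm_axis_1)
  moreover have "?a \<noteq> - ?a" by (simp add: vec_eq_iff axis_def)
  ultimately show ?thesis
    using connected_finite_iff_sing[OF c] by (metis empty_iff singletonD)
qed

lemma configs_nonempty: "configs N \<noteq> {}"
proof -
  obtain \<omega> where "finite \<omega>" "card \<omega> = N" "\<omega> \<subseteq> S2"
    using infinite_arbitrarily_large[OF infinite_S2, of N] by auto
  then show ?thesis unfolding configs_def by blast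
qed

lemma riesz2_energy_indexed:
  assumes "inj_on f {..<N}"
  shows "riesz2_energy (f ` {..<N}) =
    (\<Sum>(i, j)\<in>{(i, j). i < N \<and> j < N \<and> i \<noteq> j}. 1 / norm (f i - f j) ^ 2)"
proof -
  let ?P = "{(i, j). i < N \<and> j < N \<and> i \<noteq> j}"
  have "inj_on (map_prod f f) ?P"
    using assms by (auto simp: inj_on_def)
  moreover have "{(x, y). x \<in> f ` {..<N} \<and> y \<in> f ` {..<N} \<and> x \<noteq> y} = map_prod f f ` ?P"
    using assms by (force simp: inj_on_def)
  ultimately show ?thesis
    unfolding riesz2_energy_def by (simp add: sum.reindex case_prod_unfold)
qed

lemma simultaneous_subsequence:
  fixes g :: "nat \<Rightarrow> nat \<Rightarrow> real^3"
  assumes "\<And>k i. i < N \<Longrightarrow> g k i \<in> S2"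
  shows "\<exists>r l. strict_mono (r :: nat \<Rightarrow> nat) \<and>
    (\<forall>i<N. l i \<in> S2 \<and> (\<lambda>k. g (r k) i) \<longlonglongrightarrow> l i)"
  using assms
proof (induction N)
  case 0
  show ?case by (auto intro!: exI[of _ id] simp: strict_mono_def)
next
  case (Suc N)
  then obtain r l where r: "strict_mono r"
    and l: "\<And>i. i < N \<Longrightarrow> l i \<in> S2 \<and> (\<lambda>k. g (r k) i) \<longlonglongrightarrow> l i"
    by (metis less_Suc_eq)
  have "compact S2" by (simp add: S2_def)
  then obtain a q where a: "a \<in> S2" and q: "strict_mono (q :: nat \<Rightarrow> nat)"
    and lim: "((\<lambda>k. g (r k) N) \<circ> q) \<longlonglongrightarrow> a"
    unfolding compact_eq_seq_compact_metric seq_compact_def using Suc.prems by (metis lessI)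
  have "(\<lambda>k. g (r (q k)) i) \<longlonglongrightarrow> l i" if "i < N" for i
    using LIMSEQ_subseq_LIMSEQ[OF conjunct2[OF l[OF that]] q] by (simp add: o_def)
  then show ?case
    using a l lim strict_mono_o[OF r q]
    by (intro exI[of _ "r \<circ> q"] exI[of _ "l(N := a)"]) (auto simp: less_Suc_eq o_def)
qed

lemma riesz2_energy_attains_inf:
  "\<exists>\<omega>\<in>configs N. \<forall>\<omega>'\<in>configs N. riesz2_energy \<omega> \<le> riesz2_energy \<omega>'"
proof -
  let ?E = "riesz2_energy ` configs N"
  define m where "m = Inf ?E"
  have nonneg: "riesz2_energy \<omega> \<ge> 0" for \<omega>
    unfolding riesz2_energy_def by (intro sum_nonneg) auto
  have bdd: "bdd_below ?E" by (rule bdd_belowI[of _ 0]) (auto simp: nonneg)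
  have ne: "?E \<noteq> {}" using configs_nonempty by simp
  have "\<exists>\<omega>\<in>configs N. riesz2_energy \<omega> < m + 1 / real (Suc k)" for k
    using cInf_lessD[OF ne, of "m + 1 / real (Suc k)"] unfolding m_def by auto
  then obtain W where W: "\<And>k. W k \<in> configs N"
    and W_less: "\<And>k. riesz2_energy (W k) < m + 1 / real (Suc k)"
    by metis
  have "\<exists>f. bij_betw f {..<N} (W k)" for k
    using W[of k] ex_bij_betw_nat_finite[of "W k"]
    by (auto simp: configs_def atLeast0LessThan)
  then obtain g where g: "\<And>k. bij_betw (g k) {..<N} (W k)" by metis
  have gS: "g k i \<in> S2" if "i < N" for k i
    using bij_betwE[OF g[of k]] that W[of k] by (auto simp: configs_def)
  obtain r l where r: "strict_mono (r :: nat \<Rightarrow> nat)"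
    and l: "\<And>i. i < N \<Longrightarrow> l i \<in> S2" "\<And>i. i < N \<Longrightarrow> (\<lambda>k. g (r k) i) \<longlonglongrightarrow> l i"
    using simultaneous_subsequence[of N g] gS by blast
  let ?P = "{(i, j). i < N \<and> j < N \<and> i \<noteq> j}"
  have finP: "finite ?P" by (rule finite_subset[of _ "{..<N} \<times> {..<N}"]) auto
  have E: "riesz2_energy (W k) = (\<Sum>(i, j)\<in>?P. 1 / norm (g k i - g k j) ^ 2)" for k
    using riesz2_energy_indexed[of "g k" N] g[of k] by (simp add: bij_betw_def)
  have sep: "1 \<le> (m + 1) * norm (g k i - g k j) ^ 2" if "i < N" "j < N" "i \<noteq> j" for k i j
  proof -
    have "1 / norm (g k i - g k j) ^ 2 \<le> riesz2_energy (W k)"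
      unfolding E using member_le_sum[of "(i, j)" ?P "\<lambda>(i, j). 1 / norm (g k i - g k j) ^ 2"]
        finP that by auto
    also have "\<dots> \<le> m + 1" proof -
      have "1 / real (Suc k) \<le> 1" by simp
      then show ?thesis using W_less[of k] by linarith
    qed
    finally have "1 / norm (g k i - g k j) ^ 2 \<le> m + 1" .
    moreover have "g k i \<noteq> g k j" using g[of k] that by (auto simp: bij_betw_def inj_on_def)
    ultimately show ?thesis by (simp add: divide_le_eq)
  qed
  have dist: "l i \<noteq> l j" if "i < N" "j < N" "i \<noteq> j" for i j
  proof
    assume eq: "l i = l j"
    have "(\<lambda>k. (m + 1) * norm (g (r k) i - g (r k) j) ^ 2) \<longlonglongrightarrow> (m + 1) * norm (l i - l j) ^ 2"
      by (intro tendsto_intros l that)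
    then have "1 \<le> (m + 1) * norm (l i - l j) ^ 2"
      by (rule LIMSEQ_le_const) (use sep that in blast)
    then show False using eq by simp
  qed
  have inj: "inj_on l {..<N}" using dist by (force simp: inj_on_def)
  have conf: "l ` {..<N} \<in> configs N"
    using l inj by (auto simp: configs_def card_image)
  have lim: "(\<lambda>k. riesz2_energy (W (r k))) \<longlonglongrightarrow> riesz2_energy (l ` {..<N})"
    unfolding E riesz2_energy_indexed[OF inj] case_prod_unfold
    by (intro tendsto_intros l) (auto dest: dist)
  have "(\<lambda>k. m + 1 / real (Suc k)) \<longlonglongrightarrow> m + 0"
    by (intro tendsto_intros LIMSEQ_Suc[OF lim_1_over_n])
  then have "(\<lambda>k. m + 1 / real (Suc (r k))) \<longlonglongrightarrow> m"
    using LIMSEQ_subseq_LIMSEQ[OF _ r] by (force simp: o_def)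
  then have "riesz2_energy (l ` {..<N}) \<le> m"
    by (rule LIMSEQ_le[OF lim]) (use W_less less_imp_le in blast)
  moreover have "m \<le> riesz2_energy \<omega>'" if "\<omega>' \<in> configs N" for \<omega>'
    unfolding m_def using that bdd by (auto intro: cInf_lower)
  ultimately show ?thesis using conf by (meson order_trans)
qed

lemma min_riesz2_energy_attained:
  "\<exists>\<omega>\<in>configs N. min_riesz2_energy N = riesz2_energy \<omega>"
  and min_riesz2_energy_le: "\<omega>' \<in> configs N \<Longrightarrow> min_riesz2_energy N \<le> riesz2_energy \<omega>'"
proof -
  obtain \<omega> where \<omega>: "\<omega> \<in> configs N"
    "\<And>\<omega>'. \<omega>' \<in> configs N \<Longrightarrow> riesz2_energy \<omega> \<le> riesz2_energy \<omega>'"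
    using riesz2_energy_attains_inf by blast
  have eq: "min_riesz2_energy N = riesz2_energy \<omega>"
    unfolding min_riesz2_energy_def by (rule Least_equality) (use \<omega> in auto)
  show "\<exists>\<omega>\<in>configs N. min_riesz2_energy N = riesz2_energy \<omega>" using eq \<omega>(1) by blast
  show "min_riesz2_energy N \<le> riesz2_energy \<omega>'" if "\<omega>' \<in> configs N"
    using eq \<omega>(2)[OF that] by simp
qed

definition C_diamond2 :: real where
  "C_diamond2 = 1 / 2 * (euler_mascheroni - 1 / 2 - ln 2 / 3)"

end

theory Submission
  imports Defs "HOL-Complex_Analysis.Complex_Analysis" "HOL-Real_Asymp.Real_Asymp"
begin

text \<open>
  The upper bound comes from an explicit family of configurations. Take \<open>m\<close> circles of latitude with equally
  spaced colatitudes \<open>\<phi>\<^sub>j\<close>, about \<open>sqrt N\<close> of them, and inscribe in each circle a regular polygon with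
  \<open>r\<^sub>j \<approx> A sin \<phi>\<^sub>j\<close> vertices. The polygons may still be rotated. The mean of
  \<open>1 / norm (x - y)\<^sup>2\<close> over all positions of \<open>y\<close> on its circle is \<open>1 / (2 \<bar>z - w\<bar>)\<close>, where \<open>z\<close> and \<open>w\<close> are the
  heights of \<open>x\<close> and \<open>y\<close> (\<open>mean_inverse_dist_latitude\<close>, an instance of the mean value property of holomorphic
  functions). Choosing the rotations one after the other, each no worse than average, gives a configuration
  whose energy is at most the sum of the energies of the single polygons and of
  \<open>r\<^sub>j r\<^sub>k / \<bar>cos \<phi>\<^sub>j - cos \<phi>\<^sub>k\<bar>\<close> over all pairs of circles (\<open>ex_rotated_polygons\<close>).

  The energy of one polygon is elementary: its leading term is \<open>r\<^sup>3 / (12 (sin \<phi>)\<^sup>2)\<close>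
  (\<open>riesz2_energy_latitude_polygon_le\<close>). For the pairs of circles, the formulas for sums and products of
  sines and cosines reduce the double sum to sums of \<open>cot (l pi / (2 m))\<close> and of \<open>tan (p pi / (4 m))\<close>
  (\<open>sum_near\<close>, \<open>sum_antipodal_ge\<close>). Comparing these with integrals and with the harmonic numbers yields the
  logarithm and Euler's constant (\<open>cross_sum_le\<close>, \<open>cross_bound_asymp\<close>).

  Optimising the ratio of \<open>m\<close> to \<open>sqrt N\<close> leads to the bound \<open>N\<^sup>2 ln N / 4 + C N\<^sup>2 + o(N\<^sup>2)\<close> with
  \<open>C = (\<gamma> - ln (2 sqrt 3)) / 2 + 1 / 4\<close>, approximately \<open>-0.0826\<close> (\<open>rings_energy_asymp\<close>). The constant to be
  reached is approximately \<open>-0.0769\<close>, which is larger, so the stated inequality holds for all large \<open>N\<close> even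
  without a remainder term, and finitely many exceptions are absorbed by the remainder.
\<close>

section \<open>Points of the sphere and the mean of the kernel over a circle of latitude\<close>

text \<open>
  The point with colatitude \<open>\<phi>\<close> and longitude \<open>\<tau>\<close>.
\<close>

definition sph_pt :: "real \<Rightarrow> real \<Rightarrow> real^3" where
  "sph_pt \<phi> \<tau> = vector [sin \<phi> * cos \<tau>, sin \<phi> * sin \<tau>, cos \<phi>]"

lemma sph_pt_axis: "sph_pt \<phi> \<tau> = (sin \<phi> * cos \<tau>) *\<^sub>R axis 1 1
    + (sin \<phi> * sin \<tau>) *\<^sub>R axis 2 1 + cos \<phi> *\<^sub>R axis 3 1"
  by (simp add: sph_pt_def vec_eq_iff forall_3 axis_def)

lemma norm_power2_vec3: "norm (x :: real^3) ^ 2 = (x$1)^2 + (x$2)^2 + (x$3)^2"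
  by (simp add: norm_vec_def L2_set_def sum_3)

lemma sph_pt_height: "sph_pt \<phi> \<tau> $ 3 = cos \<phi>"
  by (simp add: sph_pt_def)

lemma sph_pt_in_S2: "sph_pt \<phi> \<tau> \<in> S2"
proof -
  have "(sin \<phi> * cos \<tau>)^2 + (sin \<phi> * sin \<tau>)^2 + (cos \<phi>)^2
      = (sin \<phi>)^2 * ((sin \<tau>)^2 + (cos \<tau>)^2) + (cos \<phi>)^2"
    unfolding power_mult_distrib by (simp only: algebra_simps)
  then have "norm (sph_pt \<phi> \<tau>) ^ 2 = 1"
    unfolding norm_power2_vec3 sph_pt_def by simp
  then have "norm (sph_pt \<phi> \<tau>) = 1"
    using power2_eq_1_iff[of "norm (sph_pt \<phi> \<tau>)"] norm_ge_zero[of "sph_pt \<phi> \<tau>"] by linarith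
  then show ?thesis by (simp add: S2_def)
qed

lemma cos_double_cos_half: "cos (x::real) = 2 * cos (x / 2) ^ 2 - 1"
  and cos_double_sin_half: "cos (x::real) = 1 - 2 * sin (x / 2) ^ 2"
  and sin_double_half: "sin (x::real) = 2 * sin (x / 2) * cos (x / 2)"
  using cos_double_cos[of "x/2"] cos_double_sin[of "x/2"] sin_double[of "x/2"]
  by (simp_all add: cos_squared_eq)

text \<open>
  The squared distance is put in the form \<open>P\<^sup>2 + Q\<^sup>2 - 2 P Q cos (s - t)\<close>, the denominator of a Poisson
  kernel, because that form can be averaged over the longitude; \<open>cos_diff_product\<close> supplies the value
  of \<open>P\<^sup>2 - Q\<^sup>2\<close>.
\<close>

lemma dist_sph_pt:
  "norm (sph_pt a s - sph_pt b t) ^ 2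
    = (2 * cos (a/2) * sin (b/2))\<^sup>2 + (2 * sin (a/2) * cos (b/2))\<^sup>2
      - 2 * (2 * cos (a/2) * sin (b/2)) * (2 * sin (a/2) * cos (b/2)) * cos (s - t)"
proof -
  have e: "sin x ^ 2 = 1 - cos x ^ 2" for x :: real by (simp add: sin_squared_eq)
  have 1: "norm (sph_pt a s - sph_pt b t) ^ 2 = (sin a * cos s - sin b * cos t)\<^sup>2
    + (sin a * sin s - sin b * sin t)\<^sup>2 + (cos a - cos b)\<^sup>2"
    unfolding norm_power2_vec3 sph_pt_def by simp
  have 2: "\<dots> = (sin a)\<^sup>2 * ((sin s)\<^sup>2 + (cos s)\<^sup>2) + (sin b)\<^sup>2 * ((sin t)\<^sup>2 + (cos t)\<^sup>2)
      - 2 * sin a * sin b * cos (s - t) + (cos a - cos b)\<^sup>2"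
    unfolding cos_diff by (simp only: power2_eq_square algebra_simps)
  have 3: "\<dots> = ((sin a)\<^sup>2 + (cos a)\<^sup>2) + ((sin b)\<^sup>2 + (cos b)\<^sup>2) - 2 * cos a * cos b
      - 2 * sin a * sin b * cos (s - t)"
    unfolding sin_cos_squared_add[of s] sin_cos_squared_add[of t] by (simp only: power2_eq_square algebra_simps mult_1_right mult_1_left)
  have 4: "(2 * cos (a/2) * sin (b/2))\<^sup>2 + (2 * sin (a/2) * cos (b/2))\<^sup>2 = 2 - 2 * cos a * cos b"
    unfolding cos_double_cos_half[of a] cos_double_cos_half[of b] power_mult_distrib e[of "a/2"] e[of "b/2"]
    by (simp add: algebra_simps power2_eq_square)
  show ?thesis unfolding 1 2 3 unfolding 4 sin_cos_squared_add
    using sin_double_half[of a] sin_double_half[of b] by (simp add: algebra_simps)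
qed

lemma cos_diff_product:
  "(2 * cos (a/2) * sin (b/2))\<^sup>2 - (2 * sin (a/2) * cos (b/2))\<^sup>2 = 2 * (cos a - cos (b::real))"
proof -
  have e: "sin x ^ 2 = 1 - cos x ^ 2" for x :: real by (simp add: sin_squared_eq)
  show ?thesis
    unfolding cos_double_cos_half[of a] cos_double_cos_half[of b] power_mult_distrib e[of "a/2"] e[of "b/2"]
    by (simp add: algebra_simps power2_eq_square)
qed

lemma chord_same_ring:
  "norm (sph_pt a s - sph_pt a t) ^ 2 = 4 * (sin a)\<^sup>2 * (sin ((s - t) / 2))\<^sup>2"
  unfolding dist_sph_pt cos_double_sin_half[of "s - t"] sin_double_half[of a]
  by (simp add: algebra_simps power2_eq_square)

lemma mean_unit_circle:
  assumes "f holomorphic_on cball 0 1"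
  shows "((\<lambda>t. f (exp (2 * of_real pi * \<i> * of_real t))) has_integral f 0) {0..1}"
proof -
  have "((\<lambda>u. f u / (u - 0)) has_contour_integral 2 * of_real pi * \<i> * f 0) (circlepath 0 1)"
    by (rule Cauchy_integral_circlepath_simple) (use assms in auto)
  then have "((\<lambda>t. 2 * of_real pi * \<i> * f (exp (2 * of_real pi * \<i> * of_real t)))
      has_integral 2 * of_real pi * \<i> * f 0) {0..1}"
    unfolding has_contour_integral vector_derivative_circlepath
    by (simp add: circlepath algebra_simps)
  then have "((\<lambda>t. (1 / (2 * of_real pi * \<i>)) * (2 * of_real pi * \<i> * f (exp (2 * of_real pi * \<i> * of_real t))))
      has_integral (1 / (2 * of_real pi * \<i>)) * (2 * of_real pi * \<i> * f 0)) {0..1}"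
    by (rule has_integral_mult_right)
  then show ?thesis by simp
qed

text \<open>
  The integrand is \<open>1 / (P\<^sup>2 - Q\<^sup>2)\<close> times the real part of \<open>(P + Q w) / (P - Q w)\<close> on the unit circle.
  This function is holomorphic on the closed disc, so its mean over the circle is its value \<open>1\<close> at \<open>0\<close>.
\<close>

lemma poisson_mean:
  fixes P Q \<tau> :: real
  assumes "\<bar>Q\<bar> < P"
  shows "((\<lambda>t. 1 / (P\<^sup>2 + Q\<^sup>2 - 2 * P * Q * cos (2 * pi * t + \<tau>))) has_integral 1 / (P\<^sup>2 - Q\<^sup>2)) {0..1}"
proof -
  \<comment> \<open>The phase \<open>\<tau>\<close> is absorbed into the function, so that periodicity of the integrand is never used.\<close>
  define c where "c = cis \<tau>"
  define f where "f u = (of_real P + of_real Q * c * u) / (of_real P - of_real Q * c * u)" for u :: complex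
  have nz: "of_real P - of_real Q * c * u \<noteq> 0" if "norm u \<le> 1" for u :: complex
  proof
    assume "of_real P - of_real Q * c * u = 0"
    then have "norm (of_real P :: complex) = norm (of_real Q * c * u)" by simp
    then have "\<bar>P\<bar> = \<bar>Q\<bar> * norm u" by (simp add: norm_mult c_def)
    also have "\<dots> \<le> \<bar>Q\<bar>" using that by (simp add: mult_left_le)
    finally show False using assms by linarith
  qed
  have "f holomorphic_on cball 0 1"
    unfolding f_def using nz by (auto intro!: holomorphic_intros)
  from has_integral_Re[OF mean_unit_circle[OF this]]
  have h: "((\<lambda>t. Re (f (exp (2 * of_real pi * \<i> * of_real t)))) has_integral 1) {0..1}"
    using assms nz[of 0] by (simp add: f_def)
  have PQ: "P\<^sup>2 - Q\<^sup>2 > 0" using assms by (metis abs_ge_zero diff_gt_0_iff_gt power2_abs power_strict_mono pos2)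
  have re: "Re (f (exp (2 * of_real pi * \<i> * of_real t)))
      = (P\<^sup>2 - Q\<^sup>2) * (1 / (P\<^sup>2 + Q\<^sup>2 - 2 * P * Q * cos (2 * pi * t + \<tau>)))" for t
  proof -
    let ?x = "2 * pi * t + \<tau>"
    have "c * exp (2 * of_real pi * \<i> * of_real t) = cis ?x"
      by (simp add: c_def cis_conv_exp exp_add [symmetric] algebra_simps)
    then have "f (exp (2 * of_real pi * \<i> * of_real t))
        = (of_real P + of_real Q * cis ?x) / (of_real P - of_real Q * cis ?x)"
      by (simp add: f_def mult.assoc)
    then have "Re (f (exp (2 * of_real pi * \<i> * of_real t)))
        = ((P + Q * cos ?x) * (P - Q * cos ?x) - (Q * sin ?x) * (Q * sin ?x))
          / ((P - Q * cos ?x)\<^sup>2 + (Q * sin ?x)\<^sup>2)"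
      by (simp add: Re_divide cmod_power2)
    also have "(P + Q * cos ?x) * (P - Q * cos ?x) - (Q * sin ?x) * (Q * sin ?x)
        = P\<^sup>2 - Q\<^sup>2 * ((sin ?x)\<^sup>2 + (cos ?x)\<^sup>2)"
      by (simp only: power2_eq_square algebra_simps)
    also have "(P - Q * cos ?x)\<^sup>2 + (Q * sin ?x)\<^sup>2
        = P\<^sup>2 + Q\<^sup>2 * ((sin ?x)\<^sup>2 + (cos ?x)\<^sup>2) - 2 * P * Q * cos ?x"
      by (simp only: power2_eq_square algebra_simps)
    finally show ?thesis by simp
  qed
  have "((\<lambda>t. (1 / (P\<^sup>2 - Q\<^sup>2)) * Re (f (exp (2 * of_real pi * \<i> * of_real t))))
      has_integral (1 / (P\<^sup>2 - Q\<^sup>2)) * 1) {0..1}"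
    by (rule has_integral_mult_right[OF h])
  then show ?thesis unfolding re using PQ by simp
qed

text \<open>
  The exponent 2 is special: the mean of the kernel over a circle of latitude depends only on the
  difference of the heights, since \<open>P\<^sup>2 - Q\<^sup>2 = 2 (cos a - cos b)\<close>. This turns the energy of the rotated
  polygons into a one-dimensional sum.
\<close>

lemma mean_inverse_dist_latitude:
  assumes "0 < a" "a < pi" "0 < b" "b < pi" "a \<noteq> b"
  shows "((\<lambda>t. 1 / norm (sph_pt a s - sph_pt b (2 * pi * t + \<tau>)) ^ 2)
     has_integral 1 / (2 * \<bar>cos a - cos b\<bar>)) {0..1}"
proof -
  define P Q where "P = 2 * cos (a/2) * sin (b/2)" and "Q = 2 * sin (a/2) * cos (b/2)"
  have pos: "P > 0" "Q > 0"
    unfolding P_def Q_def using assms by (auto intro!: mult_pos_pos cos_gt_zero sin_gt_zero)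
  have diff: "P\<^sup>2 - Q\<^sup>2 = 2 * (cos a - cos b)"
    unfolding P_def Q_def by (rule cos_diff_product)
  have eq: "norm (sph_pt a s - sph_pt b (2 * pi * t + \<tau>)) ^ 2
      = P\<^sup>2 + Q\<^sup>2 - 2 * P * Q * cos (2 * pi * t + (\<tau> - s))" for t
    unfolding dist_sph_pt P_def Q_def
    using cos_minus[of "s - (2 * pi * t + \<tau>)"] by (simp add: algebra_simps)
  show ?thesis
  proof (cases "a < b")
    case True
    then have c: "cos b < cos a" using assms by (simp add: cos_monotone_0_pi)
    then have "\<bar>Q\<bar> < P" using diff pos by (smt (verit) power_mono)
    from poisson_mean[OF this, of "\<tau> - s"] show ?thesis
      unfolding eq diff using c by simp
  next
    case False
    then have c: "cos a < cos b" using assms by (simp add: cos_monotone_0_pi)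
    have diff': "Q\<^sup>2 - P\<^sup>2 = 2 * (cos b - cos a)" using diff by simp
    from c have "\<bar>P\<bar> < Q" using diff pos by (smt (verit) power_mono)
    from poisson_mean[OF this, of "\<tau> - s"] show ?thesis
      unfolding eq diff' using c by (simp add: add.commute mult.commute mult.left_commute)
  qed
qed

section \<open>Energies of subsets and unions\<close>

lemma riesz2_energy_eq:
  assumes "finite X"
  shows "riesz2_energy X = (\<Sum>x\<in>X. \<Sum>y\<in>X - {x}. 1 / norm (x - y) ^ 2)"
proof -
  have "{(x, y). x \<in> X \<and> y \<in> X \<and> x \<noteq> y} = (SIGMA x:X. X - {x})" by auto
  then show ?thesis unfolding riesz2_energy_def using assms by (simp add: sum.Sigma)
qed

lemma riesz2_energy_mono:
  assumes "finite Y" "X \<subseteq> Y"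
  shows "riesz2_energy X \<le> riesz2_energy Y"
  unfolding riesz2_energy_def
proof (rule sum_mono2)
  show "finite {(x, y). x \<in> Y \<and> y \<in> Y \<and> x \<noteq> y}"
    by (rule finite_subset[of _ "Y \<times> Y"]) (use assms in auto)
qed (use assms in auto)

lemma riesz2_energy_Un:
  assumes fin: "finite X" "finite Y" and disj: "X \<inter> Y = {}"
  shows "riesz2_energy (X \<union> Y)
    = riesz2_energy X + riesz2_energy Y + 2 * (\<Sum>x\<in>X. \<Sum>y\<in>Y. 1 / norm (x - y) ^ 2)"
proof -
  let ?f = "\<lambda>x y. 1 / norm (x - y) ^ 2 :: real"
  have X: "(\<Sum>y\<in>(X \<union> Y) - {x}. ?f x y) = (\<Sum>y\<in>X - {x}. ?f x y) + (\<Sum>y\<in>Y. ?f x y)" if "x \<in> X" for x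
  proof -
    have "(X \<union> Y) - {x} = (X - {x}) \<union> Y" using that disj by auto
    then show ?thesis using fin disj by (simp add: sum.union_disjoint Int_Diff inf_commute Diff_Int_distrib)
  qed
  have Y: "(\<Sum>y\<in>(X \<union> Y) - {x}. ?f x y) = (\<Sum>y\<in>X. ?f x y) + (\<Sum>y\<in>Y - {x}. ?f x y)" if "x \<in> Y" for x
  proof -
    have "(X \<union> Y) - {x} = X \<union> (Y - {x})" using that disj by auto
    moreover have "X \<inter> (Y - {x}) = {}" using disj by auto
    ultimately show ?thesis using fin by (simp add: sum.union_disjoint)
  qed
  have "(\<Sum>x\<in>Y. \<Sum>y\<in>X. ?f x y) = (\<Sum>x\<in>X. \<Sum>y\<in>Y. ?f x y)"
    by (subst sum.swap) (simp add: norm_minus_commute)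
  then show ?thesis
    unfolding riesz2_energy_eq[OF fin(1)] riesz2_energy_eq[OF fin(2)] riesz2_energy_eq[OF finite_UnI[OF fin]]
    using fin disj by (simp add: sum.union_disjoint X Y sum.distrib)
qed

section \<open>Energy of a regular polygon on a circle of latitude\<close>

lemma le_tan:
  fixes x :: real
  assumes "0 \<le> x" "x < pi / 2"
  shows "x \<le> tan x"
proof -
  have "tan 0 - 0 \<le> tan x - x"
  proof (rule DERIV_nonneg_imp_nondecreasing[OF assms(1)])
    fix t assume t: "0 \<le> t" "t \<le> x"
    then have c: "cos t > 0" using assms by (intro cos_gt_zero_pi) auto
    have "((\<lambda>t. tan t - t) has_real_derivative inverse ((cos t)\<^sup>2) - 1) (at t)"
      using c by (auto intro!: derivative_eq_intros)
    moreover have "inverse ((cos t)\<^sup>2) \<ge> 1" using c by (intro one_le_inverse) (auto simp: abs_square_le_1)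
    ultimately show "\<exists>y. ((\<lambda>t. tan t - t) has_real_derivative y) (at t) \<and> 0 \<le> y"
      by (auto intro!: exI[of _ "inverse ((cos t)\<^sup>2) - 1"])
  qed
  then show ?thesis by simp
qed

text \<open>
  Equivalent to \<open>cot x \<le> 1 / x\<close>, because \<open>1 / (sin x)\<^sup>2 = 1 + (cot x)\<^sup>2\<close>.
\<close>

lemma inverse_sin_square_le:
  fixes x :: real
  assumes "0 < x" "x \<le> pi / 2"
  shows "1 / (sin x)\<^sup>2 \<le> 1 + 1 / x\<^sup>2"
proof (cases "x = pi / 2")
  case False
  then have x: "0 < x" "x < pi / 2" using assms by auto
  have s: "sin x > 0" and c: "cos x > 0" using x by (auto intro: sin_gt_zero cos_gt_zero)
  have "x \<le> tan x" using x by (intro le_tan) auto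
  then have "x\<^sup>2 \<le> (tan x)\<^sup>2" using x by (intro power_mono) auto
  then have "1 / (tan x)\<^sup>2 \<le> 1 / x\<^sup>2" using x by (intro divide_left_mono) (auto intro!: mult_pos_pos tan_gt_zero)
  moreover have "1 / (sin x)\<^sup>2 = 1 + 1 / (tan x)\<^sup>2"
    using s c sin_cos_squared_add[of x] by (simp add: tan_def power_divide field_simps)
  ultimately show ?thesis by simp
next
  case True
  then have "sin x = 1" by (simp only: sin_pi_half)
  then show ?thesis by simp
qed

text \<open>
  Each of the two halves of the range contributes at most \<open>(r / pi)\<^sup>2\<close> times Euler's \<open>pi\<^sup>2 / 6\<close>, which gives
  the leading term \<open>r\<^sup>2 / 3\<close>. The linear term is of lower order in the final estimate.
\<close>

lemma sum_inverse_sin_square_le: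
  fixes r :: nat
  shows "(\<Sum>k=1..<r. 1 / (sin (pi * real k / real r))\<^sup>2) \<le> (real r)\<^sup>2 / 3 + real r"
proof -
  define g where "g k = (real r)\<^sup>2 / pi\<^sup>2 * (1 / (real k)\<^sup>2)" for k :: nat
  have g0: "g k \<ge> 0" for k by (simp add: g_def)
  have low: "1 / (sin (pi * real k / real r))\<^sup>2 \<le> 1 + g k" if "1 \<le> k" "2 * k \<le> r" for k
  proof -
    have "1 / (sin (pi * real k / real r))\<^sup>2 \<le> 1 + 1 / (pi * real k / real r)\<^sup>2"
      by (rule inverse_sin_square_le) (use that in \<open>auto simp: field_simps\<close>)
    then show ?thesis by (simp add: g_def power_mult_distrib power_divide)
  qed
  \<comment> \<open>Adding both \<open>g k\<close> and \<open>g (r - k)\<close> costs nothing in the limit and makes the bound symmetric.\<close>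
  have each: "1 / (sin (pi * real k / real r))\<^sup>2 \<le> 1 + g k + g (r - k)" if "k \<in> {1..<r}" for k
  proof (cases "2 * k \<le> r")
    case True
    then show ?thesis using low[of k] g0[of "r - k"] that by simp
  next
    case False
    have "pi * real (r - k) / real r = pi - pi * real k / real r"
      using that by (simp add: of_nat_diff field_simps)
    then have s: "sin (pi * real (r - k) / real r) = sin (pi * real k / real r)" by (simp only: sin_pi_minus)
    have "1 / (sin (pi * real (r - k) / real r))\<^sup>2 \<le> 1 + g (r - k)"
      by (rule low) (use that False in auto)
    then show ?thesis using g0[of k] unfolding s by linarith
  qed
  have S: "(\<Sum>k=1..<r. g k) \<le> (real r)\<^sup>2 / 6"
  proof -
    have sm: "(\<lambda>n. 1 / (real (n + 1))\<^sup>2) sums (pi\<^sup>2 / 6)" using inverse_squares_sums by simp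
    have "(\<Sum>k=1..<r. 1 / (real k)\<^sup>2) = (\<Sum>n<r - 1. 1 / (real (n + 1))\<^sup>2)"
      by (rule sum.reindex_bij_witness[of _ "\<lambda>n. n + 1" "\<lambda>k. k - 1"]) auto
    also have "\<dots> \<le> pi\<^sup>2 / 6"
      using sum_le_suminf[OF sums_summable[OF sm], of "{..<r - 1}"] sums_unique[OF sm] by simp
    finally have "(real r)\<^sup>2 / pi\<^sup>2 * (\<Sum>k=1..<r. 1 / (real k)\<^sup>2) \<le> (real r)\<^sup>2 / pi\<^sup>2 * (pi\<^sup>2 / 6)"
      by (intro mult_left_mono) auto
    then show ?thesis by (simp add: g_def sum_distrib_left)
  qed
  have S': "(\<Sum>k=1..<r. g (r - k)) = (\<Sum>k=1..<r. g k)"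
    by (rule sum.reindex_bij_witness[of _ "\<lambda>k. r - k" "\<lambda>k. r - k"]) auto
  have "(\<Sum>k=1..<r. 1 / (sin (pi * real k / real r))\<^sup>2) \<le> (\<Sum>k=1..<r. 1 + g k + g (r - k))"
    by (rule sum_mono) (rule each)
  also have "\<dots> = real (r - 1) + 2 * (\<Sum>k=1..<r. g k)" by (simp add: sum.distrib S' del: One_nat_def)
  also have "\<dots> \<le> (real r)\<^sup>2 / 3 + real r" using S by linarith
  finally show ?thesis .
qed

definition latitude_polygon :: "real \<Rightarrow> nat \<Rightarrow> real \<Rightarrow> (real^3) set" where
  "latitude_polygon \<phi> r \<alpha> = (\<lambda>i. sph_pt \<phi> (\<alpha> + 2 * pi * real i / real r)) ` {..<r}"

lemma polygon_chord:
  "norm (sph_pt \<phi> (\<alpha> + 2 * pi * real i / real r) - sph_pt \<phi> (\<alpha> + 2 * pi * real j / real r)) ^ 2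
    = 4 * (sin \<phi>)\<^sup>2 * (sin (pi * (real i - real j) / real r))\<^sup>2"
  unfolding chord_same_ring by (simp add: algebra_simps diff_divide_distrib)

lemma polygon_angle_sin_pos:
  assumes "1 \<le> k" "k < r"
  shows "sin (pi * real k / real r) > 0"
  using assms by (intro sin_gt_zero) (auto simp: field_simps)

lemma polygon_inj:
  assumes "0 < \<phi>" "\<phi> < pi"
  shows "inj_on (\<lambda>i. sph_pt \<phi> (\<alpha> + 2 * pi * real i / real r)) {..<r}"
proof (rule linorder_inj_onI)
  fix i j assume ij: "i < j" "i \<in> {..<r}" "j \<in> {..<r}"
  show "sph_pt \<phi> (\<alpha> + 2 * pi * real i / real r) \<noteq> sph_pt \<phi> (\<alpha> + 2 * pi * real j / real r)"
  proof
    assume eq: "sph_pt \<phi> (\<alpha> + 2 * pi * real i / real r) = sph_pt \<phi> (\<alpha> + 2 * pi * real j / real r)"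
    have "sin (pi * (real j - real i) / real r) > 0"
      using polygon_angle_sin_pos[of "j - i" r] ij by (simp add: of_nat_diff)
    moreover have "sin \<phi> > 0" using assms by (intro sin_gt_zero)
    ultimately show False using polygon_chord[of \<phi> \<alpha> j r i] unfolding eq by simp
  qed
qed auto

lemma finite_latitude_polygon: "finite (latitude_polygon \<phi> r \<alpha>)" by (simp add: latitude_polygon_def)

lemma sum_latitude_polygon:
  assumes "0 < \<phi>" "\<phi> < pi"
  shows "(\<Sum>x\<in>latitude_polygon \<phi> r \<alpha>. g x) = (\<Sum>i<r. g (sph_pt \<phi> (\<alpha> + 2 * pi * real i / real r)))"
  unfolding latitude_polygon_def by (simp add: sum.reindex[OF polygon_inj[OF assms]])

text \<open>
  By symmetry all vertices have the same potential, a sum of \<open>1 / (2 sin \<phi> sin (pi k / r))\<^sup>2\<close> over the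
  \<open>r - 1\<close> other vertices.
\<close>

lemma riesz2_energy_latitude_polygon_le:
  assumes "0 < \<phi>" "\<phi> < pi"
  shows "riesz2_energy (latitude_polygon \<phi> r \<alpha>) \<le> ((real r)^3 + 3 * (real r)\<^sup>2) / (12 * (sin \<phi>)\<^sup>2)"
proof -
  let ?F = "\<lambda>k. 1 / (sin (pi * real k / real r))\<^sup>2"
  let ?G = "\<lambda>i j. 1 / (4 * (sin \<phi>)\<^sup>2 * (sin (pi * (real i - real j) / real r))\<^sup>2)"
  have s: "sin \<phi> > 0" using assms by (intro sin_gt_zero)
  have P: "{(i, j). i < r \<and> j < r \<and> i \<noteq> j} = (SIGMA i:{..<r}. {..<r} - {i})" by auto
  have inner: "(\<Sum>j\<in>{..<r} - {i}. ?G i j) = 1 / (4 * (sin \<phi>)\<^sup>2) * (\<Sum>k=1..<r. ?F k)" if i: "i < r" for i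
  proof -
    have "(\<Sum>j\<in>{..<r} - {i}. ?G i j) = (\<Sum>k=1..<r. 1 / (4 * (sin \<phi>)\<^sup>2) * ?F k)"
    \<comment> \<open>The index \<open>k\<close> is \<open>j - i\<close> modulo \<open>r\<close>; the summand has period \<open>r\<close> in \<open>j - i\<close> and is even.\<close>
    proof (rule sum.reindex_bij_witness[of _ "\<lambda>k. if k + i < r then k + i else k + i - r"
          "\<lambda>j. if i \<le> j then j - i else j + r - i"])
      fix j assume j: "j \<in> {..<r} - {i}"
      show "1 / (4 * (sin \<phi>)\<^sup>2) * ?F (if i \<le> j then j - i else j + r - i) = ?G i j"
      proof (cases "i \<le> j")
        case True
        have "sin (pi * real (j - i) / real r) = - sin (pi * (real i - real j) / real r)"
          unfolding sin_minus[symmetric] using True by (simp add: of_nat_diff algebra_simps diff_divide_distrib)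
        then show ?thesis using True by simp
      next
        case False
        have "pi * real (j + r - i) / real r = pi - pi * (real i - real j) / real r"
          using False i by (simp add: of_nat_diff field_simps)
        then have "sin (pi * real (j + r - i) / real r) = sin (pi * (real i - real j) / real r)" by simp
        then show ?thesis using False by simp
      qed
    qed (use i in auto)
    then show ?thesis by (simp add: sum_distrib_left)
  qed
  have "riesz2_energy (latitude_polygon \<phi> r \<alpha>) = (\<Sum>i<r. \<Sum>j\<in>{..<r} - {i}. ?G i j)"
    unfolding latitude_polygon_def riesz2_energy_indexed[OF polygon_inj[OF assms]] polygon_chord P
    by (simp add: sum.Sigma)
  also have "\<dots> = real r * (1 / (4 * (sin \<phi>)\<^sup>2) * (\<Sum>k=1..<r. ?F k))"
    using inner by simp
  also have "\<dots> \<le> real r * (1 / (4 * (sin \<phi>)\<^sup>2) * ((real r)\<^sup>2 / 3 + real r))"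
    by (intro mult_left_mono sum_inverse_sin_square_le) auto
  also have "\<dots> = ((real r)^3 + 3 * (real r)\<^sup>2) / (12 * (sin \<phi>)\<^sup>2)"
    using s by (simp add: field_simps power2_eq_square power3_eq_cube)
  finally show ?thesis .
qed

section \<open>Rotating the polygons against each other\<close>

text \<open>
  The right-hand side is the mean of the left-hand side over all rotations \<open>\<alpha>\<close>, and a continuous function
  attains a value that is at most its mean.
\<close>

lemma ex_good_rotation:
  assumes fin: "finite X" and b: "0 < b" "b < pi"
    and X: "\<And>x. x \<in> X \<Longrightarrow> \<exists>a s. 0 < a \<and> a < pi \<and> a \<noteq> b \<and> x = sph_pt a s"
  shows "\<exists>\<alpha>. (\<Sum>x\<in>X. \<Sum>y\<in>latitude_polygon b r \<alpha>. 1 / norm (x - y) ^ 2)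
    \<le> (\<Sum>x\<in>X. real r * (1 / (2 * \<bar>x $ 3 - cos b\<bar>)))"
proof -
  define f where "f t = (\<Sum>x\<in>X. \<Sum>i<r. 1 / norm (x - sph_pt b (2 * pi * t + 2 * pi * real i / real r)) ^ 2)"
    for t
  have int: "(f has_integral (\<Sum>x\<in>X. \<Sum>i<r. 1 / (2 * \<bar>x $ 3 - cos b\<bar>))) {0..1}"
    unfolding f_def
  proof (intro has_integral_sum fin finite_lessThan)
    fix x i assume "x \<in> X"
    then obtain a s where "0 < a" "a < pi" "a \<noteq> b" "x = sph_pt a s" using X by blast
    then show "((\<lambda>t. 1 / norm (x - sph_pt b (2 * pi * t + 2 * pi * real i / real r)) ^ 2)
      has_integral 1 / (2 * \<bar>x $ 3 - cos b\<bar>)) {0..1}"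
      using mean_inverse_dist_latitude[of a b s] b by (simp add: sph_pt_height)
  qed
  have "continuous_on {0..1} f"
    unfolding f_def
  proof (intro continuous_on_sum continuous_on_divide continuous_on_power continuous_on_norm
      continuous_on_diff continuous_on_const ballI)
    fix x t i assume "x \<in> X"
    then obtain a s where a: "0 < a" "a < pi" "a \<noteq> b" "x = sph_pt a s" using X by blast
    have "cos a \<noteq> cos b" using a b cos_inj_pi[of a b] by auto
    then show "(norm (x - sph_pt b (2 * pi * t + 2 * pi * real i / real r)))\<^sup>2 \<noteq> 0"
      using a(4) sph_pt_height by (metis eq_iff_diff_eq_0 norm_eq_zero zero_eq_power2)
  next
    show "continuous_on {0..1} (\<lambda>t. sph_pt b (2 * pi * t + 2 * pi * real i / real r))" for i
      unfolding sph_pt_axis by (intro continuous_intros)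
  qed
  then obtain t where t: "t \<in> {0..1}" and min: "\<And>u. u \<in> {0..1} \<Longrightarrow> f t \<le> f u"
    using continuous_attains_inf[of "{0..1::real}" f] by auto
  have "((\<lambda>u :: real. f t) has_integral f t) {0..1}"
    using has_integral_const_real[of "f t" 0 1] by simp
  from has_integral_le[OF this int min]
  have "f t \<le> (\<Sum>x\<in>X. \<Sum>i<r. 1 / (2 * \<bar>x $ 3 - cos b\<bar>))" by simp
  then show ?thesis
    by (intro exI[of _ "2 * pi * t"]) (simp add: sum_latitude_polygon[OF b] f_def)
qed

text \<open>
  The polygons are added one at a time, each in a position that is at least as good as the average
  against all the earlier ones. To evaluate that average the induction must remember how many points lie
  at each height; this is the clause about all functions \<open>g\<close> of the height. With \<open>g = 1\<close> it also counts
  the points.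
\<close>

lemma ex_rotated_polygons:
  fixes \<phi> :: "nat \<Rightarrow> real" and r :: "nat \<Rightarrow> nat"
  assumes range: "\<And>j. j < m \<Longrightarrow> 0 < \<phi> j \<and> \<phi> j < pi" and inj: "inj_on \<phi> {..<m}"
  shows "n \<le> m \<Longrightarrow> \<exists>X. finite X \<and> (\<forall>x\<in>X. \<exists>j<n. \<exists>s. x = sph_pt (\<phi> j) s)
    \<and> (\<forall>g :: real \<Rightarrow> real. (\<Sum>x\<in>X. g (x $ 3)) = (\<Sum>j<n. real (r j) * g (cos (\<phi> j))))
    \<and> riesz2_energy X \<le> (\<Sum>j<n. (real (r j)^3 + 3 * (real (r j))\<^sup>2) / (12 * (sin (\<phi> j))\<^sup>2))
      + (\<Sum>k<n. \<Sum>j<k. real (r j) * real (r k) / \<bar>cos (\<phi> j) - cos (\<phi> k)\<bar>)"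
proof (induction n)
  case 0
  show ?case by (rule exI[of _ "{}"]) (auto simp: riesz2_energy_def)
next
  case (Suc n)
  then obtain X :: "(real^3) set" where X: "finite X" "\<And>x. x \<in> X \<Longrightarrow> \<exists>j<n. \<exists>s. x = sph_pt (\<phi> j) s"
    and height: "\<And>g :: real \<Rightarrow> real. (\<Sum>x\<in>X. g (x $ 3)) = (\<Sum>j<n. real (r j) * g (cos (\<phi> j)))"
    and E: "riesz2_energy X \<le> (\<Sum>j<n. (real (r j)^3 + 3 * (real (r j))\<^sup>2) / (12 * (sin (\<phi> j))\<^sup>2))
      + (\<Sum>k<n. \<Sum>j<k. real (r j) * real (r k) / \<bar>cos (\<phi> j) - cos (\<phi> k)\<bar>)"
    by auto
  have b: "0 < \<phi> n" "\<phi> n < pi" using range Suc.prems by auto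
  have ne: "\<phi> j \<noteq> \<phi> n" if "j < n" for j
    using inj_on_eq_iff[OF inj, of j n] that Suc.prems by simp
  obtain \<alpha> where \<alpha>: "(\<Sum>x\<in>X. \<Sum>y\<in>latitude_polygon (\<phi> n) (r n) \<alpha>. 1 / norm (x - y) ^ 2)
    \<le> (\<Sum>x\<in>X. real (r n) * (1 / (2 * \<bar>x $ 3 - cos (\<phi> n)\<bar>)))"
  proof -
    have "\<exists>a s. 0 < a \<and> a < pi \<and> a \<noteq> \<phi> n \<and> x = sph_pt a s" if x: "x \<in> X" for x
    proof -
      obtain j s where "j < n" "x = sph_pt (\<phi> j) s" using X(2)[OF x] by blast
      then show ?thesis using range[of j] ne[of j] Suc.prems by auto
    qed
    from ex_good_rotation[OF X(1) b this] show ?thesis using that by blast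
  qed
  define Y where "Y = latitude_polygon (\<phi> n) (r n) \<alpha>"
  have Y: "y \<in> Y \<Longrightarrow> \<exists>s. y = sph_pt (\<phi> n) s" for y by (auto simp: Y_def latitude_polygon_def)
  have disj: "X \<inter> Y = {}"
  proof (rule ccontr)
    assume "X \<inter> Y \<noteq> {}"
    then obtain x where "x \<in> X" "x \<in> Y" by auto
    then obtain j s s' where j: "j < n" "sph_pt (\<phi> j) s = sph_pt (\<phi> n) s'" using X(2) Y by metis
    then have "cos (\<phi> j) = cos (\<phi> n)" by (metis sph_pt_height)
    then show False using ne[OF j(1)] range[of j] b cos_inj_pi[of "\<phi> j" "\<phi> n"] Suc.prems j(1) by auto
  qed
  have finY: "finite Y" by (simp add: Y_def finite_latitude_polygon)
  have E': "riesz2_energy (X \<union> Y) \<le>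
      (\<Sum>j<Suc n. (real (r j)^3 + 3 * (real (r j))\<^sup>2) / (12 * (sin (\<phi> j))\<^sup>2))
      + (\<Sum>k<Suc n. \<Sum>j<k. real (r j) * real (r k) / \<bar>cos (\<phi> j) - cos (\<phi> k)\<bar>)"
  proof -
    have "(\<Sum>x\<in>X. real (r n) * (1 / (2 * \<bar>x $ 3 - cos (\<phi> n)\<bar>)))
        = (\<Sum>j<n. real (r j) * (real (r n) * (1 / (2 * \<bar>cos (\<phi> j) - cos (\<phi> n)\<bar>))))"
      by (rule height)
    then have "2 * (\<Sum>x\<in>X. \<Sum>y\<in>Y. 1 / norm (x - y) ^ 2)
        \<le> 2 * (\<Sum>j<n. real (r j) * (real (r n) * (1 / (2 * \<bar>cos (\<phi> j) - cos (\<phi> n)\<bar>))))"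
      using \<alpha> by (simp add: Y_def)
    also have "\<dots> = (\<Sum>j<n. real (r j) * real (r n) / \<bar>cos (\<phi> j) - cos (\<phi> n)\<bar>)"
      unfolding sum_distrib_left by (rule sum.cong) auto
    finally show ?thesis
      using riesz2_energy_Un[OF X(1) finY disj] E
        riesz2_energy_latitude_polygon_le[OF b, of "r n" \<alpha>, folded Y_def] by simp
  qed
  have height': "(\<Sum>x\<in>X \<union> Y. g (x $ 3)) = (\<Sum>j<Suc n. real (r j) * g (cos (\<phi> j)))" for g :: "real \<Rightarrow> real"
    using X(1) finY disj height[of g]
    by (simp add: sum.union_disjoint Y_def sum_latitude_polygon[OF b] sph_pt_height)
  have "\<forall>x\<in>X \<union> Y. \<exists>j<Suc n. \<exists>s. x = sph_pt (\<phi> j) s"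
    using X(2) Y less_Suc_eq by blast
  then show ?case using X(1) finY height' E' by (intro exI[of _ "X \<union> Y"]) auto
qed

section \<open>Interaction of equally spaced latitudes\<close>

lemma sin_progression_sum:
  fixes c \<theta> :: real
  shows "2 * sin \<theta> * (\<Sum>j<n. sin ((2 * real j + c + 1) * \<theta>)) = cos (c * \<theta>) - cos ((2 * real n + c) * \<theta>)"
proof (induction n)
  case (Suc n)
  have "2 * sin \<theta> * sin ((2 * real n + c + 1) * \<theta>)
      = cos ((2 * real n + c) * \<theta>) - cos ((2 * real (Suc n) + c) * \<theta>)"
    using cos_diff[of "(2 * real n + c + 1) * \<theta>" \<theta>] cos_add[of "(2 * real n + c + 1) * \<theta>" \<theta>]
    by (simp add: algebra_simps)
  then show ?case using Suc by (simp add: distrib_left)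
qed simp

lemma sin_progression_sum':
  fixes p \<theta> :: real
  shows "2 * sin \<theta> * (\<Sum>j<n. sin ((p - 1 - 2 * real j) * \<theta>)) = cos ((p - 2 * real n) * \<theta>) - cos (p * \<theta>)"
proof -
  have "sin ((2 * real j + (- p) + 1) * (- \<theta>)) = sin ((p - 1 - 2 * real j) * \<theta>)"
    "cos ((2 * real n + (- p)) * (- \<theta>)) = cos ((p - 2 * real n) * \<theta>)" for j
    by (simp_all add: algebra_simps)
  then show ?thesis using sin_progression_sum[where c = "- p" and \<theta> = "- \<theta>" and n = n] by (simp add: sum_negf)
qed

text \<open>
  With \<open>s = (a + b) / 2\<close> and \<open>d = (b - a) / 2\<close> this is
  \<open>sin a sin b = (sin s)\<^sup>2 - (sin d)\<^sup>2\<close> divided by \<open>cos a - cos b = 2 sin s sin d\<close>.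
\<close>

lemma pair_term_eq:
  fixes a b :: real
  assumes "0 < a" "a < b" "b < pi"
  shows "sin a * sin b / \<bar>cos a - cos b\<bar>
    = (sin ((a + b) / 2) / sin ((b - a) / 2) - sin ((b - a) / 2) / sin ((a + b) / 2)) / 2"
proof -
  define s d where "s = (a + b) / 2" and "d = (b - a) / 2"
  have ab: "a = s - d" "b = s + d" by (simp_all add: s_def d_def field_simps)
  have sd: "sin s > 0" "sin d > 0" using assms by (auto intro!: sin_gt_zero simp: s_def d_def)
  have "cos b < cos a" using assms by (simp add: cos_monotone_0_pi)
  moreover have "cos a - cos b = 2 * sin s * sin d" unfolding ab by (simp add: cos_add cos_diff)
  moreover have "sin a * sin b = (sin s)\<^sup>2 - (sin d)\<^sup>2"
    unfolding ab sin_add sin_diff using sin_cos_squared_add[of s] sin_cos_squared_add[of d] by algebra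
  ultimately show ?thesis using sd unfolding s_def[symmetric] d_def[symmetric]
    by (simp add: field_simps power2_eq_square)
qed

text \<open>
  The colatitudes used are \<open>(2 j + 1) \<theta>\<close> for \<open>j < m\<close>, where \<open>\<theta> = pi / (2 m)\<close>: the midpoints of \<open>m\<close>
  equal parts of the interval from \<open>0\<close> to \<open>pi\<close>. For a pair \<open>j < k\<close> the half sum and the half difference in
  \<open>pair_term_eq\<close> are \<open>(j + k + 1) \<theta>\<close> and \<open>(k - j) \<theta>\<close>, so each of the two parts can be summed exactly along
  the diagonals on which its denominator is constant.
\<close>

locale latitudes =
  fixes m :: nat
  assumes m: "m \<ge> 1"
begin

definition \<theta> :: real where "\<theta> = pi / (2 * real m)"

lemma m_theta: "2 * real m * \<theta> = pi" using m by (simp add: \<theta>_def)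

lemma theta_pos: "\<theta> > 0"
  using m by (simp add: \<theta>_def)

lemma sin_pos: "0 < p \<Longrightarrow> p < 2 * real m \<Longrightarrow> sin (p * \<theta>) > 0"
  using theta_pos m_theta by (intro sin_gt_zero) (auto simp: mult_strict_right_mono[of p "2 * real m" \<theta>, unfolded m_theta])

lemma sin_theta_pos: "sin \<theta> > 0" using sin_pos[of 1] m by simp

lemma sum_sin_latitudes: "(\<Sum>j<m. sin ((2 * real j + 1) * \<theta>)) = 1 / sin \<theta>"
proof -
  have "cos ((2 * real m + 0) * \<theta>) = - 1" using m_theta by simp
  then have "2 * sin \<theta> * (\<Sum>j<m. sin ((2 * real j + 1) * \<theta>)) = 2"
    using sin_progression_sum[where \<theta> = \<theta> and n = m and c = 0] by simp
  then show ?thesis using sin_theta_pos by (simp add: field_simps)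
qed

text \<open>
  For fixed \<open>l = k - j\<close> the numerators are sines in arithmetic progression, placed symmetrically about
  \<open>pi / 2\<close>, with sum \<open>cos (l \<theta>) / sin \<theta>\<close>. This part carries the logarithm.
\<close>

lemma sum_near: 
  "(\<Sum>k<m. \<Sum>j<k. sin ((real j + real k + 1) * \<theta>) / sin ((real k - real j) * \<theta>))
    = (\<Sum>l=1..<m. cot (real l * \<theta>)) / sin \<theta>"
proof -
  have "(\<Sum>k<m. \<Sum>j<k. sin ((real j + real k + 1) * \<theta>) / sin ((real k - real j) * \<theta>))
    = (\<Sum>l=1..<m. \<Sum>j<m - l. sin ((2 * real j + real l + 1) * \<theta>) / sin (real l * \<theta>))"
    unfolding sum.Sigma[OF finite_lessThan ballI[OF finite_lessThan]]
      sum.Sigma[OF finite_atLeastLessThan ballI[OF finite_lessThan]]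
    by (rule sum.reindex_bij_witness[of _ "\<lambda>(l, j). (j + l, j)" "\<lambda>(k, j). (k - j, j)"])
      (auto simp: of_nat_diff algebra_simps)
  also have "\<dots> = (\<Sum>l=1..<m. cot (real l * \<theta>) / sin \<theta>)"
  proof (rule sum.cong[OF refl])
    fix l assume l: "l \<in> {1..<m}"
    have "(2 * real (m - l) + real l) * \<theta> = pi - real l * \<theta>"
      using l m_theta by (simp add: of_nat_diff algebra_simps)
    then have "2 * sin \<theta> * (\<Sum>j<m - l. sin ((2 * real j + real l + 1) * \<theta>)) = 2 * cos (real l * \<theta>)"
      unfolding sin_progression_sum by simp
    then have "(\<Sum>j<m - l. sin ((2 * real j + real l + 1) * \<theta>)) = cos (real l * \<theta>) / sin \<theta>"
      using sin_theta_pos by (simp add: field_simps)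
    then show "(\<Sum>j<m - l. sin ((2 * real j + real l + 1) * \<theta>) / sin (real l * \<theta>)) = cot (real l * \<theta>) / sin \<theta>"
      by (simp add: cot_def flip: sum_divide_distrib)
  qed
  finally show ?thesis by (simp add: sum_divide_distrib)
qed

text \<open>
  Here \<open>p = j + k + 1\<close> is fixed. The sines of \<open>(k - j) \<theta>\<close> then sum to about
  \<open>(1 - cos (p \<theta>)) / (2 sin \<theta>)\<close>, and division by \<open>sin (p \<theta>)\<close> produces \<open>tan (p \<theta> / 2)\<close>. The reflection in the
  equator exchanges \<open>p\<close> and \<open>2 m - p\<close>, so the diagonals \<open>p < m\<close> are counted twice and the diagonal \<open>p = m\<close>,
  of lower order, is discarded. A lower bound is what is needed, because this part enters the energy with a
  negative sign.
\<close>

lemma sum_antipodal_ge: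
  "(\<Sum>p=1..<m. tan (real p * \<theta> / 2) - tan (\<theta> / 2)) / sin \<theta>
   \<le> (\<Sum>k<m. \<Sum>j<k. sin ((real k - real j) * \<theta>) / sin ((real j + real k + 1) * \<theta>))"
proof -
  define f where "f = (\<lambda>(k, j). sin ((real k - real j) * \<theta>) / sin ((real j + real k + 1) * \<theta>))"
  define T where "T = (SIGMA p:{1..<m}. {..<p div 2})"
  \<comment> \<open>The map \<open>u\<close> parametrises the pairs with \<open>j + k + 1 = p\<close>, and \<open>v\<close> their mirror images in the equator.\<close>
  define u where "u = (\<lambda>(p, j). (p - 1 - j, j) :: nat \<times> nat)"
  define v where "v = (\<lambda>(p, j). (m - 1 - j, m - 1 - (p - 1 - j)) :: nat \<times> nat)"
  have finT: "finite T" by (simp add: T_def)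
  have T: "2 * j + 2 \<le> p" "p < m" if "(p, j) \<in> T" for p j
    using that by (auto simp: T_def)
  have u: "f (u (p, j)) = sin ((real p - 1 - 2 * real j) * \<theta>) / sin (real p * \<theta>)" if "(p, j) \<in> T" for p j
    using T[OF that] by (simp add: f_def u_def of_nat_diff algebra_simps)
  have v: "f (v (p, j)) = sin ((real p - 1 - 2 * real j) * \<theta>) / sin (real p * \<theta>)" if "(p, j) \<in> T" for p j
  proof -
    have "(real (m - 1 - (p - 1 - j)) + real (m - 1 - j) + 1) * \<theta> = pi - real p * \<theta>"
      using T[OF that] m_theta by (simp add: of_nat_diff algebra_simps)
    moreover have "real (m - 1 - j) - real (m - 1 - (p - 1 - j)) = real p - 1 - 2 * real j"
      using T[OF that] by (simp add: of_nat_diff)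
    ultimately show ?thesis by (simp only: f_def v_def prod.case sin_pi_minus)
  qed
  have injT: "inj_on u T" "inj_on v T"
  proof (safe intro!: inj_onI)
    fix p j p' j'
    assume pj: "(p, j) \<in> T" "(p', j') \<in> T"
    show "p = p'" "j = j'" if "u (p, j) = u (p', j')"
      using that T[OF pj(1)] T[OF pj(2)] by (auto simp: u_def)
    show "p = p'" "j = j'" if "v (p, j) = v (p', j')"
      using that T[OF pj(1)] T[OF pj(2)] by (auto simp: v_def)
  qed
  have disj: "u ` T \<inter> v ` T = {}"
  proof (rule ccontr)
    assume "u ` T \<inter> v ` T \<noteq> {}"
    then obtain p j p' j' where "(p, j) \<in> T" "(p', j') \<in> T" "u (p, j) = v (p', j')" by force
    then show False using T[of p j] T[of p' j'] by (auto simp: u_def v_def)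
  qed
  have W: "(tan (real p * \<theta> / 2) - tan (\<theta> / 2)) / (2 * sin \<theta>)
      \<le> (\<Sum>j<p div 2. sin ((real p - 1 - 2 * real j) * \<theta>) / sin (real p * \<theta>))"
    if p: "p \<in> {1..<m}" for p
  proof -
    have pp: "sin (real p * \<theta>) > 0" using sin_pos[of "real p"] p by simp
    have "real p * \<theta> < real m * \<theta>" using theta_pos p by simp
    then have half: "0 < \<theta> / 2" "\<theta> / 2 \<le> real p * \<theta> / 2" "real p * \<theta> < pi / 2"
      using theta_pos p m_theta by (auto, linarith)
    \<comment> \<open>The parity of \<open>p\<close> decides whether the telescoping sum starts at \<open>cos 0\<close> or at \<open>cos \<theta>\<close>; the smaller value serves for both.\<close>
    have "cos \<theta> \<le> cos ((real p - 2 * real (p div 2)) * \<theta>)"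
    proof (cases "even p")
      case True
      then show ?thesis by (auto elim!: evenE)
    next
      case False
      then show ?thesis by (auto elim!: oddE)
    qed
    then have A: "cos \<theta> - cos (real p * \<theta>) \<le> 2 * sin \<theta> * (\<Sum>j<p div 2. sin ((real p - 1 - 2 * real j) * \<theta>))"
      unfolding sin_progression_sum' by simp
    have tan_half: "(1 - cos x) / sin x = tan (x / 2)" if "0 < x" "x < pi" for x :: real
    proof -
      have "sin (x / 2) > 0" "cos (x / 2) > 0" using that by (auto intro: sin_gt_zero cos_gt_zero)
      moreover have "1 - cos x = 2 * sin (x / 2) * sin (x / 2)" "sin x = 2 * sin (x / 2) * cos (x / 2)"
        using cos_double_sin[of "x / 2"] sin_double[of "x / 2"] by (simp_all add: power2_eq_square)
      ultimately show ?thesis by (simp add: tan_def)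
    qed
    have "sin \<theta> \<le> sin (real p * \<theta>)"
      using half pi_gt_zero by (intro sin_monotone_2pi_le) linarith+
    then have "(1 - cos \<theta>) / sin (real p * \<theta>) \<le> (1 - cos \<theta>) / sin \<theta>"
      using sin_theta_pos by (intro divide_left_mono mult_pos_pos pp) auto
    also have "\<dots> = tan (\<theta> / 2)" by (intro tan_half) (use half pi_gt_zero in linarith)+
    finally have "tan (real p * \<theta> / 2) - tan (\<theta> / 2) \<le> (1 - cos (real p * \<theta>)) / sin (real p * \<theta>) - (1 - cos \<theta>) / sin (real p * \<theta>)"
      using tan_half[of "real p * \<theta>"] half by (auto simp: mult_pos_pos)
    also have "\<dots> = (cos \<theta> - cos (real p * \<theta>)) / sin (real p * \<theta>)" by (simp add: diff_divide_distrib)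
    also have "\<dots> \<le> (2 * sin \<theta> * (\<Sum>j<p div 2. sin ((real p - 1 - 2 * real j) * \<theta>))) / sin (real p * \<theta>)"
      using A pp by (intro divide_right_mono) auto
    also have "\<dots> = 2 * sin \<theta> * (\<Sum>j<p div 2. sin ((real p - 1 - 2 * real j) * \<theta>) / sin (real p * \<theta>))"
      by (simp flip: sum_divide_distrib)
    finally show ?thesis using sin_theta_pos by (simp add: pos_divide_le_eq mult.commute)
  qed
  have "(\<Sum>p=1..<m. tan (real p * \<theta> / 2) - tan (\<theta> / 2)) / sin \<theta>
      = 2 * (\<Sum>p=1..<m. (tan (real p * \<theta> / 2) - tan (\<theta> / 2)) / (2 * sin \<theta>))"
    using sin_theta_pos by (simp flip: sum_divide_distrib)
  also have "\<dots> \<le> 2 * (\<Sum>p=1..<m. \<Sum>j<p div 2. sin ((real p - 1 - 2 * real j) * \<theta>) / sin (real p * \<theta>))"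
    by (intro mult_left_mono sum_mono W) auto
  also have "\<dots> = (\<Sum>t\<in>T. f (u t)) + (\<Sum>t\<in>T. f (v t))"
  proof -
    have "(\<Sum>p=1..<m. \<Sum>j<p div 2. sin ((real p - 1 - 2 * real j) * \<theta>) / sin (real p * \<theta>))
       = (\<Sum>(p, j)\<in>T. sin ((real p - 1 - 2 * real j) * \<theta>) / sin (real p * \<theta>))"
      unfolding T_def by (rule sum.Sigma) auto
    moreover have "(\<Sum>t\<in>T. f (u t)) = (\<Sum>(p, j)\<in>T. sin ((real p - 1 - 2 * real j) * \<theta>) / sin (real p * \<theta>))"
      by (rule sum.cong) (use u in auto)
    moreover have "(\<Sum>t\<in>T. f (v t)) = (\<Sum>(p, j)\<in>T. sin ((real p - 1 - 2 * real j) * \<theta>) / sin (real p * \<theta>))"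
      by (rule sum.cong) (use v in auto)
    ultimately show ?thesis by simp
  qed
  also have "\<dots> = (\<Sum>t\<in>u ` T \<union> v ` T. f t)"
    using finT disj by (simp add: sum.union_disjoint sum.reindex[OF injT(1)] sum.reindex[OF injT(2)])
  also have "\<dots> \<le> (\<Sum>t\<in>(SIGMA k:{..<m}. {..<k}). f t)"
  proof (rule sum_mono2)
    show "u ` T \<union> v ` T \<subseteq> (SIGMA k:{..<m}. {..<k})"
    proof -
      have "u (p, j) \<in> (SIGMA k:{..<m}. {..<k})" "v (p, j) \<in> (SIGMA k:{..<m}. {..<k})" if "(p, j) \<in> T" for p j
        using T[OF that] by (auto simp: u_def v_def)
      then show ?thesis by (intro Un_least image_subsetI) (metis surj_pair)+
    qed
    fix t assume "t \<in> (SIGMA k:{..<m}. {..<k}) - (u ` T \<union> v ` T)"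
    then obtain k j where t: "t = (k, j)" "j < k" "k < m" by auto
    then show "f t \<ge> 0"
      unfolding f_def using sin_pos[of "real k - real j"] sin_pos[of "real j + real k + 1"] by auto
  qed auto
  also have "\<dots> = (\<Sum>k<m. \<Sum>j<k. sin ((real k - real j) * \<theta>) / sin ((real j + real k + 1) * \<theta>))"
    unfolding f_def by (simp add: sum.Sigma)
  finally show ?thesis .
qed

end

text \<open>
  A right Riemann sum of the increasing function \<open>tan\<close>, whose primitive is \<open>- ln cos\<close>.
\<close>

lemma tan_sum_ge:
  fixes \<eta> :: real
  assumes "0 < \<eta>" "real n * \<eta> < pi / 2"
  shows "- ln (cos (real n * \<eta>)) \<le> \<eta> * (\<Sum>p=1..n. tan (real p * \<eta>))"
  using assms(2)
proof (induction n)
  case (Suc n)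
  let ?x = "real n * \<eta>" and ?y = "real (Suc n) * \<eta>"
  have xy: "0 \<le> ?x" "?x < ?y" "?y < pi / 2" using assms(1) Suc.prems by auto
  have "\<exists>z. ?x < z \<and> z < ?y \<and> (- ln (cos ?y)) - (- ln (cos ?x)) = (?y - ?x) * tan z"
  proof (rule MVT2[OF xy(2)])
    fix t assume "?x \<le> t" "t \<le> ?y"
    then have "cos t > 0" using xy by (intro cos_gt_zero_pi) auto
    then show "((\<lambda>t. - ln (cos t)) has_real_derivative tan t) (at t)"
      by (auto intro!: derivative_eq_intros simp: tan_def)
  qed
  then obtain z where z: "?x < z" "z < ?y" "- ln (cos ?y) + ln (cos ?x) = \<eta> * tan z"
    by (auto simp: algebra_simps)
  have "tan z \<le> tan ?y" using z xy by (intro tan_mono_le) auto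
  then have "\<eta> * tan z \<le> \<eta> * tan ?y" using assms(1) by simp
  then show ?case using Suc.IH xy z(3) by (simp add: distrib_left)
qed simp

text \<open>
  The harmonic sum accounts for the singularity of \<open>cot\<close> at \<open>0\<close>. The remainder \<open>1 / x - cot x\<close> is increasing
  with primitive \<open>ln (x / sin x)\<close>, so its right Riemann sum dominates the integral. The term \<open>l = 1\<close>, where
  the formula for the primitive breaks down at the left end \<open>0\<close>, is only bounded below by \<open>0\<close>, whence the correction
  \<open>ln (\<theta> / sin \<theta>)\<close>, which tends to \<open>0\<close>.
\<close>

lemma cot_sum_le:
  fixes \<theta> :: real
  assumes "0 < \<theta>" "real n * \<theta> \<le> pi / 2" "n \<ge> 1"
  shows "\<theta> * (\<Sum>l=1..n. cot (real l * \<theta>))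
    \<le> harm n - ln (real n * \<theta> / sin (real n * \<theta>)) + ln (\<theta> / sin \<theta>)"
  using assms(3,2)
proof (induction n rule: dec_induct)
  case base
  have "\<theta> * cot \<theta> \<le> 1"
  proof (cases "\<theta> = pi / 2")
    case True
    then have "cos \<theta> = 0" by (simp only: cos_pi_half)
    then show ?thesis by (simp add: cot_def)
  next
    case False
    then have "\<theta> < pi / 2" using base by simp
    then have "\<theta> \<le> tan \<theta>" "sin \<theta> > 0" "cos \<theta> > 0"
      using assms(1) by (auto intro: le_tan sin_gt_zero cos_gt_zero)
    then show ?thesis by (simp add: cot_def tan_def field_simps)
  qed
  then show ?case by (simp add: harm_def)
next
  case (step n)
  let ?x = "real n * \<theta>" and ?y = "real (Suc n) * \<theta>"
  let ?h = "\<lambda>t::real. ln t - ln (sin t)"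
  have xy: "0 < ?x" "?x < ?y" "?y \<le> pi / 2" using assms(1) step by auto
  have s: "sin t > 0" if "0 < t" "t \<le> ?y" for t
    using that xy by (intro sin_gt_zero) auto
  have "\<exists>z. ?x < z \<and> z < ?y \<and> ?h ?y - ?h ?x = (?y - ?x) * (1 / z - cot z)"
  proof (rule MVT2[OF xy(2)])
    fix t assume "?x \<le> t" "t \<le> ?y"
    then have "0 < t" "sin t > 0" using s xy by auto
    then show "(?h has_real_derivative 1 / t - cot t) (at t)"
      by (auto intro!: derivative_eq_intros simp: cot_def)
  qed
  then obtain z where z: "?x < z" "z < ?y" "?h ?y - ?h ?x = \<theta> * (1 / z - cot z)"
    by (auto simp: algebra_simps)
  have "1 / z - cot z \<le> 1 / ?y - cot ?y"
  proof (rule DERIV_nonneg_imp_nondecreasing[of z ?y "\<lambda>t. 1 / t - cot t"])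
    fix t assume "z \<le> t" "t \<le> ?y"
    then have t: "0 < t" "sin t > 0" using s xy z by auto
    have "((\<lambda>t. 1 / t - cot t) has_real_derivative 1 / (sin t)\<^sup>2 - 1 / t\<^sup>2) (at t)"
      using t by (auto intro!: derivative_eq_intros DERIV_cot simp: power2_eq_square field_simps)
    moreover have "(sin t)\<^sup>2 \<le> t\<^sup>2" using t sin_x_le_x[of t] by (intro power_mono) auto
    then have "1 / (sin t)\<^sup>2 - 1 / t\<^sup>2 \<ge> 0" using t by (simp add: divide_simps)
    ultimately show "\<exists>y. ((\<lambda>t. 1 / t - cot t) has_real_derivative y) (at t) \<and> 0 \<le> y" by blast
  qed (use z in simp)
  then have "\<theta> * (1 / z - cot z) \<le> \<theta> * (1 / ?y - cot ?y)" using assms(1) by simp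
  also have "\<dots> = 1 / real (Suc n) - \<theta> * cot ?y" using assms(1) by (simp add: right_diff_distrib)
  finally have "\<theta> * cot ?y \<le> 1 / real (Suc n) - (?h ?y - ?h ?x)" using z(3) by linarith
  moreover have "?h ?y = ln (?y / sin ?y)" "?h ?x = ln (?x / sin ?x)"
    using xy s[of ?x] s[of ?y] by (simp_all add: ln_div)
  moreover have "\<theta> * (\<Sum>l=1..n. cot (real l * \<theta>)) \<le> harm n - ln (?x / sin ?x) + ln (\<theta> / sin \<theta>)"
    using step.IH xy by simp
  moreover have "harm (Suc n) = harm n + 1 / real (Suc n)" by (simp add: harm_Suc inverse_eq_divide)
  moreover have "(\<Sum>l=1..Suc n. cot (real l * \<theta>)) = (\<Sum>l=1..n. cot (real l * \<theta>)) + cot ?y" by simp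
  ultimately show ?case by (simp only: distrib_left)
qed

context latitudes begin

text \<open>
  The upper bound for \<open>(sin \<theta>)\<^sup>2\<close> times the interaction of all pairs of distinct latitudes that results
  from the estimates for \<open>cot\<close> and \<open>tan\<close>. The factor \<open>(sin \<theta>)\<^sup>2\<close> makes it grow only logarithmically.
\<close>

definition cross_bound :: real where
  "cross_bound = (sin \<theta> / \<theta> * (harm m - ln (pi / 2) + ln (\<theta> / sin \<theta>) + 2 * ln (cos (real (m - 1) * (\<theta> / 2))))
     + real (m - 1) * sin \<theta> * tan (\<theta> / 2)) / 2"

lemma cross_sum_le:
  "(sin \<theta>)\<^sup>2 * (\<Sum>k<m. \<Sum>j<k. sin ((2 * real j + 1) * \<theta>) * sin ((2 * real k + 1) * \<theta>)
      / \<bar>cos ((2 * real j + 1) * \<theta>) - cos ((2 * real k + 1) * \<theta>)\<bar>) \<le> cross_bound"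
proof -
  have cotb: "(\<Sum>l=1..<m. cot (real l * \<theta>)) \<le> (harm m - ln (pi / 2) + ln (\<theta> / sin \<theta>)) / \<theta>"
  proof -
    have mt: "real m * \<theta> = pi / 2" using m_theta by simp
    have "{1..m} = insert m {1..<m}" using m by auto
    then have "(\<Sum>l=1..m. cot (real l * \<theta>)) = (\<Sum>l=1..<m. cot (real l * \<theta>))"
      by (simp add: mt cot_def)
    then have "\<theta> * (\<Sum>l=1..<m. cot (real l * \<theta>)) \<le> harm m - ln (pi / 2) + ln (\<theta> / sin \<theta>)"
      using cot_sum_le[of \<theta> m] theta_pos m mt by simp
    then show ?thesis using theta_pos by (simp add: field_simps)
  qed
  have tanb: "- (2 * ln (cos (real (m - 1) * (\<theta> / 2)))) / \<theta> - real (m - 1) * tan (\<theta> / 2)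
      \<le> (\<Sum>p=1..<m. tan (real p * \<theta> / 2) - tan (\<theta> / 2))"
  proof -
    have e: "{1..<m} = {1..m - 1}" using m by auto
    have "real (m - 1) * \<theta> \<le> real m * \<theta>" using theta_pos by simp
    then have "real (m - 1) * (\<theta> / 2) < pi / 2" using m_theta pi_gt_zero by linarith
    then have "- ln (cos (real (m - 1) * (\<theta> / 2))) \<le> \<theta> / 2 * (\<Sum>p=1..m - 1. tan (real p * (\<theta> / 2)))"
      using theta_pos by (intro tan_sum_ge) auto
    then have "- (2 * ln (cos (real (m - 1) * (\<theta> / 2)))) / \<theta> \<le> (\<Sum>p=1..m - 1. tan (real p * \<theta> / 2))"
      using theta_pos by (simp add: field_simps)
    then show ?thesis unfolding e by (simp add: sum_subtractf)
  qed
  have kernel: "sin ((2 * real j + 1) * \<theta>) * sin ((2 * real k + 1) * \<theta>)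
      / \<bar>cos ((2 * real j + 1) * \<theta>) - cos ((2 * real k + 1) * \<theta>)\<bar>
    = (sin ((real j + real k + 1) * \<theta>) / sin ((real k - real j) * \<theta>)
      - sin ((real k - real j) * \<theta>) / sin ((real j + real k + 1) * \<theta>)) / 2"
    if "j < k" "k < m" for j k
  proof -
    have "(2 * real k + 1) * \<theta> < 2 * real m * \<theta>" "(2 * real j + 1) * \<theta> < (2 * real k + 1) * \<theta>"
      using theta_pos that by simp_all
    then have "0 < (2 * real j + 1) * \<theta>" "(2 * real j + 1) * \<theta> < (2 * real k + 1) * \<theta>" "(2 * real k + 1) * \<theta> < pi"
      using theta_pos m_theta by simp_all
    note K = pair_term_eq[OF this]
    have "((2 * real j + 1) * \<theta> + (2 * real k + 1) * \<theta>) / 2 = (real j + real k + 1) * \<theta>"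
      "((2 * real k + 1) * \<theta> - (2 * real j + 1) * \<theta>) / 2 = (real k - real j) * \<theta>"
      by (simp_all add: field_simps)
    then show ?thesis using K by simp
  qed
  have "(\<Sum>k<m. \<Sum>j<k. sin ((2 * real j + 1) * \<theta>) * sin ((2 * real k + 1) * \<theta>)
      / \<bar>cos ((2 * real j + 1) * \<theta>) - cos ((2 * real k + 1) * \<theta>)\<bar>)
    = ((\<Sum>k<m. \<Sum>j<k. sin ((real j + real k + 1) * \<theta>) / sin ((real k - real j) * \<theta>))
     - (\<Sum>k<m. \<Sum>j<k. sin ((real k - real j) * \<theta>) / sin ((real j + real k + 1) * \<theta>))) / 2"
    unfolding sum_subtractf[symmetric] sum_divide_distrib
    by (intro sum.cong refl kernel) auto
  also have "\<dots> \<le> ((harm m - ln (pi / 2) + ln (\<theta> / sin \<theta>)) / \<theta> / sin \<theta>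
      - (- (2 * ln (cos (real (m - 1) * (\<theta> / 2)))) / \<theta> - real (m - 1) * tan (\<theta> / 2)) / sin \<theta>) / 2"
    unfolding sum_near
    by (intro divide_right_mono diff_mono order.trans[OF _ sum_antipodal_ge] cotb tanb) (use sin_theta_pos in auto)
  finally have "(sin \<theta>)\<^sup>2 * (\<Sum>k<m. \<Sum>j<k. sin ((2 * real j + 1) * \<theta>) * sin ((2 * real k + 1) * \<theta>)
      / \<bar>cos ((2 * real j + 1) * \<theta>) - cos ((2 * real k + 1) * \<theta>)\<bar>)
      \<le> (sin \<theta>)\<^sup>2 * (((harm m - ln (pi / 2) + ln (\<theta> / sin \<theta>)) / \<theta> / sin \<theta>
      - (- (2 * ln (cos (real (m - 1) * (\<theta> / 2)))) / \<theta> - real (m - 1) * tan (\<theta> / 2)) / sin \<theta>) / 2)"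
    by (intro mult_left_mono) auto
  also have "\<dots> = cross_bound"
    unfolding cross_bound_def using sin_theta_pos theta_pos by (simp add: field_simps power2_eq_square)
  finally show ?thesis .
qed

end

section \<open>Asymptotics and choice of the parameters\<close>

text \<open>
  The constant is half the sum of three contributions: \<open>\<gamma>\<close> from the harmonic numbers, \<open>- ln (pi / 2)\<close> from the
  cotangents, and \<open>2 ln (cos (pi / 4)) = - ln 2\<close> from the tangents.
\<close>

lemma cross_bound_asymp:
  "(\<lambda>m. latitudes.cross_bound m - ln (real m) / 2) \<longlonglongrightarrow> (euler_mascheroni - ln pi) / 2"
proof -
  define h where "h m = pi / (2 * real m)" for m :: nat
  have a1: "(\<lambda>m. sin (h m) / h m) \<longlonglongrightarrow> 1" unfolding h_def by real_asymp
  have a2: "(\<lambda>m. harm m - ln (real m)) \<longlonglongrightarrow> (euler_mascheroni :: real)" by (rule euler_mascheroni_LIMSEQ)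
  have a3: "(\<lambda>m. ln (h m / sin (h m))) \<longlonglongrightarrow> 0" unfolding h_def by real_asymp
  have a4: "(\<lambda>m. ln (cos (real (m - 1) * (h m / 2)))) \<longlonglongrightarrow> ln (cos (pi / 4))"
  proof -
    have "(\<lambda>m. real (m - 1) * (h m / 2)) \<longlonglongrightarrow> pi / 4" 
    proof (rule Lim_transform_eventually)
      show "(\<lambda>m. (real m - 1) * (h m / 2)) \<longlonglongrightarrow> pi / 4" unfolding h_def by real_asymp
      show "\<forall>\<^sub>F m in sequentially. (real m - 1) * (h m / 2) = real (m - 1) * (h m / 2)"
        using eventually_ge_at_top[of 1] by eventually_elim (simp add: of_nat_diff)
    qed
    then show ?thesis by (intro tendsto_ln tendsto_cos) (auto simp: cos_45)
  qed
  have a5: "(\<lambda>m. real (m - 1) * sin (h m) * tan (h m / 2)) \<longlonglongrightarrow> 0"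
  proof (rule Lim_transform_eventually)
    show "(\<lambda>m. (real m - 1) * sin (h m) * tan (h m / 2)) \<longlonglongrightarrow> 0" unfolding h_def by real_asymp
    show "\<forall>\<^sub>F m in sequentially. (real m - 1) * sin (h m) * tan (h m / 2) = real (m - 1) * sin (h m) * tan (h m / 2)"
      using eventually_ge_at_top[of 1] by eventually_elim (simp add: of_nat_diff)
  qed
  have a6: "(\<lambda>m. (sin (h m) / h m - 1) * ln (real m)) \<longlonglongrightarrow> 0" unfolding h_def by real_asymp
  define F where "F m = (sin (h m) / h m * ((harm m - ln (real m)) - ln (pi / 2) + ln (h m / sin (h m))
        + 2 * ln (cos (real (m - 1) * (h m / 2))))
      + real (m - 1) * sin (h m) * tan (h m / 2)
      + (sin (h m) / h m - 1) * ln (real m)) / 2" for m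
  have "F \<longlonglongrightarrow> (1 * (euler_mascheroni - ln (pi / 2) + 0 + 2 * ln (cos (pi / 4))) + 0 + 0) / 2"
    unfolding F_def
    by (rule tendsto_divide[OF tendsto_add[OF tendsto_add[OF tendsto_mult[OF a1 tendsto_add[OF tendsto_add[OF
            tendsto_diff[OF a2 tendsto_const] a3] tendsto_mult[OF tendsto_const a4]]] a5] a6] tendsto_const]) simp
  moreover have "(1 * (euler_mascheroni - ln (pi / 2) + 0 + 2 * ln (cos (pi / 4))) + 0 + 0) / 2
      = (euler_mascheroni - ln pi) / (2::real)"
  proof -
    have "2 * ln (cos (pi / 4)) = - ln (2::real)" by (simp add: cos_45 ln_div ln_sqrt)
    then show ?thesis by (simp add: ln_div)
  qed
  ultimately have L: "F \<longlonglongrightarrow> (euler_mascheroni - ln pi) / 2" by (simp only:)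
  show ?thesis
  proof (rule Lim_transform_eventually[OF L])
    show "\<forall>\<^sub>F m in sequentially. F m = latitudes.cross_bound m - ln (real m) / 2"
      using eventually_ge_at_top[of 1]
    proof eventually_elim
      case (elim m)
      then interpret latitudes m by unfold_locales
      have "\<theta> = h m" by (simp add: \<theta>_def h_def)
      moreover have "(A * ((H - L) - c + d + e) + s + (A - 1) * L) / 2 = (A * (H - c + d + e) + s) / 2 - L / 2"
        for A H L c d e s :: real by (simp add: field_simps)
      ultimately show ?case unfolding cross_bound_def F_def by metis
    qed
  qed
qed

text \<open>
  The number of points on the circle of colatitude \<open>\<phi>\<close> should be proportional to its length, that is
  \<open>A sin \<phi>\<close>. Rounding down only decreases every term of the energy bound, but loses up to one point per
  circle. Since the values \<open>sin \<phi>\<close> sum to \<open>1 / sin \<theta>\<close>, the choice \<open>A = (N + m) sin \<theta>\<close> still leaves at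
  least \<open>N\<close> points, and surplus points are removed, which again decreases the energy.
\<close>

lemma (in latitudes) min_riesz2_energy_le_rings:
  "min_riesz2_energy N \<le> (real N + real m)\<^sup>2 * ((sin \<theta>)\<^sup>2 * (real N + 4 * real m) / 12 + cross_bound)"
proof -
  define A where "A = (real N + real m) * sin \<theta>"
  define \<phi> where "\<phi> j = (2 * real j + 1) * \<theta>" for j :: nat
  define r where "r j = nat \<lfloor>A * sin (\<phi> j)\<rfloor>" for j
  have A: "A \<ge> 0" using sin_theta_pos by (simp add: A_def)
  have \<phi>: "0 < \<phi> j \<and> \<phi> j < pi" if "j < m" for j
  proof -
    have "(2 * real j + 1) * \<theta> < 2 * real m * \<theta>" using theta_pos that by simp
    then show ?thesis using theta_pos m_theta by (simp add: \<phi>_def)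
  qed
  have s: "sin (\<phi> j) > 0" if "j < m" for j using \<phi>[OF that] by (auto intro: sin_gt_zero)
  have inj: "inj_on \<phi> {..<m}" using theta_pos by (auto simp: inj_on_def \<phi>_def)
  have r_le: "real (r j) \<le> A * sin (\<phi> j)" and r_ge: "A * sin (\<phi> j) - 1 \<le> real (r j)" if "j < m" for j
    using A s[OF that] by (simp_all add: r_def)
  obtain X :: "(real^3) set" where X: "finite X" "\<forall>x\<in>X. \<exists>j<m. \<exists>s. x = sph_pt (\<phi> j) s"
    and height: "\<forall>g :: real \<Rightarrow> real. (\<Sum>x\<in>X. g (x $ 3)) = (\<Sum>j<m. real (r j) * g (cos (\<phi> j)))"
    and E: "riesz2_energy X \<le> (\<Sum>j<m. (real (r j)^3 + 3 * (real (r j))\<^sup>2) / (12 * (sin (\<phi> j))\<^sup>2))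
      + (\<Sum>k<m. \<Sum>j<k. real (r j) * real (r k) / \<bar>cos (\<phi> j) - cos (\<phi> k)\<bar>)"
    using ex_rotated_polygons[where r = r and \<phi> = \<phi> and m = m and n = m] \<phi> inj by blast
  have "A * (\<Sum>j<m. sin (\<phi> j)) - real m = real N"
    unfolding \<phi>_def sum_sin_latitudes A_def using sin_theta_pos by simp
  moreover have "A * (\<Sum>j<m. sin (\<phi> j)) - real m = (\<Sum>j<m. A * sin (\<phi> j) - 1)"
    by (simp add: sum_subtractf sum_distrib_left)
  moreover have "\<dots> \<le> (\<Sum>j<m. real (r j))" by (intro sum_mono r_ge) auto
  moreover have "(\<Sum>j<m. real (r j)) = real (card X)"
    using height[rule_format, of "\<lambda>_. 1"] by simp
  ultimately have "N \<le> card X" by linarith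
  then obtain Y where Y: "Y \<subseteq> X" "card Y = N" "finite Y"
    by (rule obtain_subset_with_card_n)
  have "Y \<in> configs N" using Y X sph_pt_in_S2 by (fastforce simp: configs_def)
  then have "min_riesz2_energy N \<le> riesz2_energy Y" by (rule min_riesz2_energy_le)
  also have "\<dots> \<le> riesz2_energy X" by (rule riesz2_energy_mono[OF X(1) Y(1)])
  also note E
  also have "(\<Sum>j<m. (real (r j)^3 + 3 * (real (r j))\<^sup>2) / (12 * (sin (\<phi> j))\<^sup>2))
      \<le> (\<Sum>j<m. (A ^ 3 * sin (\<phi> j) + 3 * A\<^sup>2) / 12)"
  proof (rule sum_mono)
    fix j assume "j \<in> {..<m}"
    then have j: "j < m" by simp
    have "(real (r j)^3 + 3 * (real (r j))\<^sup>2) / (12 * (sin (\<phi> j))\<^sup>2)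
        \<le> ((A * sin (\<phi> j))^3 + 3 * (A * sin (\<phi> j))\<^sup>2) / (12 * (sin (\<phi> j))\<^sup>2)"
      by (intro divide_right_mono add_mono mult_left_mono power_mono r_le[OF j]) auto
    also have "\<dots> = (A ^ 3 * sin (\<phi> j) + 3 * A\<^sup>2) / 12"
      using s[OF j] by (simp add: field_simps power2_eq_square power3_eq_cube)
    finally show "(real (r j)^3 + 3 * (real (r j))\<^sup>2) / (12 * (sin (\<phi> j))\<^sup>2)
      \<le> (A ^ 3 * sin (\<phi> j) + 3 * A\<^sup>2) / 12" .
  qed
  also have "(\<Sum>j<m. (A ^ 3 * sin (\<phi> j) + 3 * A\<^sup>2) / 12)
      = (A ^ 3 * (\<Sum>j<m. sin (\<phi> j)) + 3 * A\<^sup>2 * real m) / 12"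
    by (simp add: sum.distrib sum_distrib_left algebra_simps flip: sum_divide_distrib)
  also have "\<dots> = (real N + real m)\<^sup>2 * ((sin \<theta>)\<^sup>2 * (real N + 4 * real m) / 12)"
    unfolding \<phi>_def sum_sin_latitudes A_def using sin_theta_pos
    by (simp add: field_simps power2_eq_square power3_eq_cube)
  also have "(\<Sum>k<m. \<Sum>j<k. real (r j) * real (r k) / \<bar>cos (\<phi> j) - cos (\<phi> k)\<bar>)
      \<le> (\<Sum>k<m. \<Sum>j<k. A\<^sup>2 * (sin (\<phi> j) * sin (\<phi> k) / \<bar>cos (\<phi> j) - cos (\<phi> k)\<bar>))"
  proof (intro sum_mono)
    fix k j assume "k \<in> {..<m}" "j \<in> {..<k}"
    then have "k < m" "j < m" by auto
    then have "real (r j) * real (r k) \<le> (A * sin (\<phi> j)) * (A * sin (\<phi> k))"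
      using A s[of j] by (intro mult_mono r_le) auto
    then have "real (r j) * real (r k) / \<bar>cos (\<phi> j) - cos (\<phi> k)\<bar>
        \<le> (A * sin (\<phi> j)) * (A * sin (\<phi> k)) / \<bar>cos (\<phi> j) - cos (\<phi> k)\<bar>"
      by (intro divide_right_mono) auto
    then show "real (r j) * real (r k) / \<bar>cos (\<phi> j) - cos (\<phi> k)\<bar>
        \<le> A\<^sup>2 * (sin (\<phi> j) * sin (\<phi> k) / \<bar>cos (\<phi> j) - cos (\<phi> k)\<bar>)"
      by (simp add: power2_eq_square mult_ac)
  qed
  also have "\<dots> = (real N + real m)\<^sup>2 * ((sin \<theta>)\<^sup>2 * (\<Sum>k<m. \<Sum>j<k. sin (\<phi> j) * sin (\<phi> k) / \<bar>cos (\<phi> j) - cos (\<phi> k)\<bar>))"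
    unfolding sum_distrib_left[symmetric] A_def power_mult_distrib by simp
  also have "\<dots> \<le> (real N + real m)\<^sup>2 * cross_bound"
    unfolding \<phi>_def by (intro mult_left_mono cross_sum_le) auto
  finally show ?thesis by (simp add: distrib_left)
qed

text \<open>
  With about \<open>\<kappa> sqrt N\<close> circles the energy bound is \<open>N\<^sup>2 ln N / 4\<close> plus \<open>N\<^sup>2\<close> times
  \<open>\<gamma> / 2 + ln (\<kappa> / pi) / 2 + pi\<^sup>2 / (48 \<kappa>\<^sup>2)\<close>. The value \<open>\<kappa> = pi / (2 sqrt 3)\<close> minimises this expression.
\<close>

definition num_rings :: "nat \<Rightarrow> nat" where
  "num_rings N = nat \<lceil>pi / (2 * sqrt 3) * sqrt (real N)\<rceil>"

lemma filterlim_num_rings: "filterlim num_rings at_top at_top"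
proof -
  have "filterlim (\<lambda>N. real_of_int \<lceil>pi / (2 * sqrt 3) * sqrt (real N)\<rceil>) at_top at_top" by real_asymp
  then have "filterlim (\<lambda>N. real (num_rings N)) at_top at_top" by (simp add: num_rings_def of_nat_nat)
  then show ?thesis
    unfolding filterlim_at_top by (metis (mono_tags, lifting) eventually_mono of_nat_le_iff)
qed

text \<open>
  The energies inside the polygons contribute \<open>1 / 4\<close>. In the interaction, half of \<open>ln m\<close> for
  \<open>m = num_rings N\<close> is \<open>ln N / 4 + ln (pi / (2 sqrt 3)) / 2 + o(1)\<close>, and its constant combines with
  \<open>(\<gamma> - ln pi) / 2\<close>. Replacing \<open>N + m\<close> by \<open>N\<close> in front is harmless because \<open>m ln m / N\<close> tends to \<open>0\<close>.
\<close>

lemma rings_energy_asymp: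
  "(\<lambda>N. (real N + real (num_rings N))\<^sup>2 * ((sin (latitudes.\<theta> (num_rings N)))\<^sup>2 * (real N + 4 * real (num_rings N)) / 12
      + latitudes.cross_bound (num_rings N)) / (real N)\<^sup>2 - ln (real N) / 4)
   \<longlonglongrightarrow> (euler_mascheroni - ln (2 * sqrt 3)) / 2 + 1 / 4"
proof -
  have K: "real (num_rings N) = real_of_int \<lceil>pi / (2 * sqrt 3) * sqrt (real N)\<rceil>" for N
    by (simp add: num_rings_def of_nat_nat)
  have b1: "(\<lambda>N. real (num_rings N) / real N) \<longlonglongrightarrow> 0" unfolding K by real_asymp
  have b2: "(\<lambda>N. (2 * (real (num_rings N) / real N) + (real (num_rings N) / real N)\<^sup>2) * ln (real (num_rings N))) \<longlonglongrightarrow> 0"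
    unfolding K by real_asymp
  have b3: "(\<lambda>N. ln (real (num_rings N)) - ln (real N) / 2) \<longlonglongrightarrow> ln (pi / (2 * sqrt 3))"
    unfolding K sqrt_def by real_asymp
  have b4: "(\<lambda>N. (sin (pi / (2 * real (num_rings N))))\<^sup>2 * (real N + 4 * real (num_rings N)) / 12) \<longlonglongrightarrow> 1 / 4"
  proof (rule Lim_transform_eventually)
    have "(\<lambda>m. real m * sin (pi / (2 * real m))) \<longlonglongrightarrow> pi / 2" by real_asymp
    then have c1: "(\<lambda>N. real (num_rings N) * sin (pi / (2 * real (num_rings N)))) \<longlonglongrightarrow> pi / 2"
      by (rule filterlim_compose) (rule filterlim_num_rings)
    have c2: "(\<lambda>N. real (num_rings N) / sqrt (real N)) \<longlonglongrightarrow> pi / (2 * sqrt 3)"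
      unfolding K sqrt_def by real_asymp
    let ?G = "\<lambda>N. (real (num_rings N) * sin (pi / (2 * real (num_rings N))))\<^sup>2 * (1 + 4 * (real (num_rings N) / real N))
        / (12 * (real (num_rings N) / sqrt (real N))\<^sup>2)"
    have "?G \<longlonglongrightarrow> (pi / 2)\<^sup>2 * (1 + 4 * 0) / (12 * (pi / (2 * sqrt 3))\<^sup>2)"
      by (intro tendsto_divide tendsto_mult tendsto_power tendsto_add tendsto_const b1 c1 c2) simp
    then show "?G \<longlonglongrightarrow> 1 / 4" by (simp add: power_divide power_mult_distrib)
    show "\<forall>\<^sub>F N in sequentially. ?G N
      = (sin (pi / (2 * real (num_rings N))))\<^sup>2 * (real N + 4 * real (num_rings N)) / 12"
      using eventually_gt_at_top[of 0] filterlim_num_rings[unfolded filterlim_at_top, rule_format, of 1]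
    proof eventually_elim
      case (elim N)
      have "(M * S)\<^sup>2 * (1 + 4 * (M / n)) / (12 * (M / sqrt n)\<^sup>2) = S\<^sup>2 * (n + 4 * M) / 12"
        if "n > 0" "M > 0" for n M S :: real
        using that by (simp add: power_mult_distrib power_divide field_simps)
      then show ?case using elim by simp
    qed
  qed
  have b5: "(\<lambda>N. latitudes.cross_bound (num_rings N) - ln (real (num_rings N)) / 2)
    \<longlonglongrightarrow> (euler_mascheroni - ln pi) / 2"
    by (rule filterlim_compose[OF cross_bound_asymp filterlim_num_rings])
  define F where "F N = (1 + real (num_rings N) / real N)\<^sup>2
        * ((sin (pi / (2 * real (num_rings N))))\<^sup>2 * (real N + 4 * real (num_rings N)) / 12
          + (latitudes.cross_bound (num_rings N) - ln (real (num_rings N)) / 2))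
      + (ln (real (num_rings N)) - ln (real N) / 2) / 2
      + (2 * (real (num_rings N) / real N) + (real (num_rings N) / real N)\<^sup>2) * ln (real (num_rings N)) / 2" for N
  have L: "F \<longlonglongrightarrow> (1 + 0)\<^sup>2 * (1 / 4 + (euler_mascheroni - ln pi) / 2) + ln (pi / (2 * sqrt 3)) / 2 + 0 / 2"
    unfolding F_def
    by (intro tendsto_add tendsto_mult tendsto_power tendsto_divide[OF b3] tendsto_divide[OF b2] b1 b4 b5 tendsto_const) simp_all
  have "(1 + 0)\<^sup>2 * (1 / 4 + (euler_mascheroni - ln pi) / 2) + ln (pi / (2 * sqrt 3)) / 2 + 0 / 2
      = (euler_mascheroni - ln (2 * sqrt 3)) / 2 + 1 / (4::real)"
    by (simp add: ln_div field_simps)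
  note L = L[unfolded this]
  show ?thesis
  proof (rule Lim_transform_eventually[OF L])
    show "\<forall>\<^sub>F N in sequentially. F N
      = (real N + real (num_rings N))\<^sup>2 * ((sin (latitudes.\<theta> (num_rings N)))\<^sup>2 * (real N + 4 * real (num_rings N)) / 12
        + latitudes.cross_bound (num_rings N)) / (real N)\<^sup>2 - ln (real N) / 4"
      using eventually_gt_at_top[of 0] filterlim_num_rings[unfolded filterlim_at_top, rule_format, of 1]
    proof eventually_elim
      case (elim N)
      then interpret latitudes "num_rings N" by unfold_locales
      have alg: "(1 + M / n)\<^sup>2 * (S + (c - L / 2)) + (L - K / 2) / 2 + (2 * (M / n) + (M / n)\<^sup>2) * L / 2
          = (n + M)\<^sup>2 * (S + c) / n\<^sup>2 - K / 4" if "n > 0" for M n S c L K :: real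
        using that by (simp add: field_simps power2_eq_square)
      show ?case unfolding \<theta>_def F_def by (rule alg) (use elim in simp)
    qed
  qed
qed

text \<open>
  Clearing denominators, the claim is \<open>6 < 4 ln 2 + 3 ln 3\<close>, that is \<open>exp 6 < 432\<close>.
\<close>

lemma rings_constant_less: "(euler_mascheroni - ln (2 * sqrt 3)) / 2 + 1 / 4 < C_diamond2"
proof -
  have "exp (6::real) = exp 1 ^ 6" by (simp flip: exp_of_nat_mult)
  also have "\<dots> \<le> (272 / 100) ^ 6" using e_less_272 by (intro power_mono) auto
  also have "\<dots> < 2 ^ 4 * (3::real) ^ 3" by (simp add: power_divide)
  finally have "ln (exp 6) < ln (2 ^ 4 * (3::real) ^ 3)" by (subst ln_less_cancel_iff) auto
  then have "6 < ln (2 ^ 4 * (3::real) ^ 3)" by simp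
  also have "\<dots> = 4 * ln 2 + 3 * ln (3::real)" by (simp only: ln_mult ln_realpow) (simp add: ln_mult ln_realpow)
  finally show ?thesis by (simp add: C_diamond2_def ln_mult ln_sqrt field_simps)
qed

text \<open>
  Because the constant reached by the polygons is strictly smaller than the required one, the positive part
  of the excess over the main terms vanishes for all large \<open>N\<close>; it is taken as the remainder.
\<close>

theorem corollary1p3:
  shows "\<exists>r :: nat \<Rightarrow> real. r \<in> o(\<lambda>N. (real N)\<^sup>2) \<and>
    (\<forall>N\<ge>2. min_riesz2_energy N
      \<le> 1 / 4 * (real N)\<^sup>2 * ln (real N) + C_diamond2 * (real N)\<^sup>2 + r N)"
proof -
  let ?main = "\<lambda>N. 1 / 4 * (real N)\<^sup>2 * ln (real N) + C_diamond2 * (real N)\<^sup>2"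
  define r where "r N = max 0 (min_riesz2_energy N - ?main N)" for N
  have "\<forall>\<^sub>F N in sequentially. r N = 0"
    using order_tendstoD(2)[OF rings_energy_asymp rings_constant_less] eventually_gt_at_top[of 0]
      filterlim_num_rings[unfolded filterlim_at_top, rule_format, of 1]
  proof eventually_elim
    case (elim N)
    then interpret latitudes "num_rings N" by unfold_locales
    let ?B = "(real N + real (num_rings N))\<^sup>2 * ((sin \<theta>)\<^sup>2 * (real N + 4 * real (num_rings N)) / 12 + cross_bound)"
    have "?B / (real N)\<^sup>2 < ln (real N) / 4 + C_diamond2" using elim(1) by simp
    then have "?B < (ln (real N) / 4 + C_diamond2) * (real N)\<^sup>2" using elim(2) by (simp add: pos_divide_less_eq)
    then have "min_riesz2_energy N < ?main N"
      using min_riesz2_energy_le_rings[of N] by (simp add: algebra_simps)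
    then show ?case by (simp add: r_def)
  qed
  then have "r \<in> o(\<lambda>N. (real N)\<^sup>2)"
    using landau_o.small.in_cong[of r "\<lambda>_. 0" sequentially] by simp
  then show ?thesis by (intro exI[of _ r]) (auto simp: r_def)
qed

end
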